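(* Let $\Sigma=S^2$ with a fixed Riemannian metric, let $k\ge 0$ and $M\ge 1$ be integers and let $p$ be a positive even integer. Then the function $$N_k:L^p_k(\Sigma,\mathbf{R}^M)\to\mathbf{R},\qquad N_k(f)=\|f\|_{k,p}^p=\sum_{i=0}^k\|\nabla^i f\|_{p}^p=\sum_{i=0}^k\int_\Sigma|\nabla^i f|^p\,d\mathrm{vol}_\Sigma,$$ is smooth (of class $C^\infty$).
   Context: $L^p_k(\Sigma,\mathbf{R}^M)$ is the Sobolev space of maps $\Sigma\to\mathbf{R}^M$ with weak derivatives up to order $k$ in $L^p$; $\nabla^i f$ is the $i$-th covariant derivative and $|\cdot|$ is the norm induced by the Riemannian metric and the Euclidean inner product. Smoothness is in the Fréchet sense on Banach spaces. *)

theory Defs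
  imports "HOL-Analysis.Analysis"
begin

section \<open>Smooth functions and weak derivatives on the plane\<close>

primrec Ck_on :: "nat \<Rightarrow> 'a::euclidean_space set \<Rightarrow> ('a \<Rightarrow> 'b::real_normed_vector) \<Rightarrow> bool" where
  "Ck_on 0 S f \<longleftrightarrow> continuous_on S f"
| "Ck_on (Suc n) S f \<longleftrightarrow>
     (\<forall>x\<in>S. f differentiable (at x)) \<and> (\<forall>v. Ck_on n S (\<lambda>x. frechet_derivative f (at x) v))"

definition smooth_on :: "'a::euclidean_space set \<Rightarrow> ('a \<Rightarrow> 'b::real_normed_vector) \<Rightarrow> bool" where
  "smooth_on S f \<longleftrightarrow> (\<forall>n. Ck_on n S f)"

definition partial :: "2 \<Rightarrow> (real^2 \<Rightarrow> 'b::real_normed_vector) \<Rightarrow> real^2 \<Rightarrow> 'b" where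
  "partial j u x = frechet_derivative u (at x) (axis j 1)"

definition test_function :: "(real^2 \<Rightarrow> real) \<Rightarrow> bool" where
  "test_function \<phi> \<longleftrightarrow> smooth_on UNIV \<phi> \<and> (\<exists>K. compact K \<and> (\<forall>x. x \<notin> K \<longrightarrow> \<phi> x = 0))"

definition locally_integrable :: "(real^2 \<Rightarrow> 'b::euclidean_space) \<Rightarrow> bool" where
  "locally_integrable u \<longleftrightarrow> (\<forall>K. compact K \<longrightarrow> set_integrable lborel K u)"

definition weak_partial :: "2 \<Rightarrow> (real^2 \<Rightarrow> 'b::euclidean_space) \<Rightarrow> (real^2 \<Rightarrow> 'b) \<Rightarrow> bool" where
  "weak_partial j u w \<longleftrightarrow> locally_integrable u \<and> locally_integrable w \<and>
     (\<forall>\<phi>. test_function \<phi> \<longrightarrow>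
        (LINT x|lborel. partial j \<phi> x *\<^sub>R u x) = - (LINT x|lborel. \<phi> x *\<^sub>R w x))"

section \<open>Multilinear maps and smoothness on normed spaces given by a carrier\<close>

text \<open>
  The Sobolev space depends on the values \<open>k\<close>, \<open>p\<close> and on the metric, so it cannot be a type of
  class \<^class>\<open>real_normed_vector\<close>. Normed spaces are therefore given by a carrier \<open>V\<close>,
  an addition, a scalar multiplication and a norm. An \<open>n\<close>-linear map takes its
  arguments as a list of length \<open>n\<close>.
\<close>

definition multilinear_on ::
  "('v \<Rightarrow> 'v \<Rightarrow> 'v) \<Rightarrow> (real \<Rightarrow> 'v \<Rightarrow> 'v) \<Rightarrow> 'v set \<Rightarrow> nat \<Rightarrow> ('v list \<Rightarrow> 'w::real_vector) \<Rightarrow> bool" where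
  "multilinear_on add scl V n B \<longleftrightarrow>
     (\<forall>xs ys. length xs + 1 + length ys = n \<longrightarrow> set xs \<subseteq> V \<longrightarrow> set ys \<subseteq> V \<longrightarrow>
        (\<forall>v\<in>V. \<forall>w\<in>V. B (xs @ add v w # ys) = B (xs @ v # ys) + B (xs @ w # ys)) \<and>
        (\<forall>v\<in>V. \<forall>c. B (xs @ scl c v # ys) = c *\<^sub>R B (xs @ v # ys)))"

definition bounded_form :: "('v \<Rightarrow> real) \<Rightarrow> 'v set \<Rightarrow> nat \<Rightarrow> real \<Rightarrow> ('v list \<Rightarrow> real) \<Rightarrow> bool" where
  "bounded_form nrm V n C B \<longleftrightarrow>
     (\<forall>vs. length vs = n \<longrightarrow> set vs \<subseteq> V \<longrightarrow> \<bar>B vs\<bar> \<le> C * prod_list (map nrm vs))"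

text \<open>
  \<open>F\<close> is smooth in the Frechet sense: there are maps \<open>D j\<close> from \<open>V\<close> to the bounded
  \<open>j\<close>-linear forms on \<open>V\<close> with \<open>D 0 = F\<close>, such that each \<open>D j\<close> is Frechet differentiable, for
  the operator norm on \<open>j\<close>-linear forms, with derivative \<open>D (Suc j)\<close> at every point. Here
  a bounded linear map from \<open>V\<close> to the bounded \<open>j\<close>-linear forms is identified as usual with
  a bounded \<open>(j+1)\<close>-linear form, the direction of differentiation being the first argument.
\<close>

definition frechet_smooth ::
  "'v set \<Rightarrow> ('v \<Rightarrow> 'v \<Rightarrow> 'v) \<Rightarrow> (real \<Rightarrow> 'v \<Rightarrow> 'v) \<Rightarrow> ('v \<Rightarrow> real) \<Rightarrow> ('v \<Rightarrow> real) \<Rightarrow> bool" where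
  "frechet_smooth V add scl nrm F \<longleftrightarrow>
     (\<exists>D :: nat \<Rightarrow> 'v \<Rightarrow> 'v list \<Rightarrow> real.
        (\<forall>x\<in>V. D 0 x [] = F x) \<and>
        (\<forall>j. \<forall>x\<in>V. multilinear_on add scl V j (D j x) \<and> (\<exists>C. bounded_form nrm V j C (D j x))) \<and>
        (\<forall>j. \<forall>x\<in>V. \<forall>\<epsilon>>0. \<exists>\<delta>>0. \<forall>h\<in>V. nrm h < \<delta> \<longrightarrow>
           bounded_form nrm V j (\<epsilon> * nrm h)
             (\<lambda>vs. D j (add x h) vs - D j x vs - D (Suc j) x (h # vs))))"

section \<open>Riemannian metrics on the two-sphere\<close>

abbreviation S2 :: "(real^3) set" where
  "S2 \<equiv> sphere 0 1"

definition tangent :: "real^3 \<Rightarrow> (real^3) set" where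
  "tangent x = {v. x \<bullet> v = 0}"

datatype pole = North | South

primrec pole_sign :: "pole \<Rightarrow> real" where
  "pole_sign North = 1"
| "pole_sign South = -1"

text \<open>
  Inverse of the stereographic projection from the given pole; it parametrizes the sphere
  minus that pole, and the two parametrizations form an atlas.
\<close>

definition stereo :: "pole \<Rightarrow> real^2 \<Rightarrow> real^3" where
  "stereo s u = (1 / ((norm u)\<^sup>2 + 1)) *\<^sub>R vector [2 * u$1, 2 * u$2, pole_sign s * ((norm u)\<^sup>2 - 1)]"

text \<open>
  A metric assigns to \<open>x\<close> a bilinear form on the ambient space, of which only the restriction
  to the tangent plane at \<open>x\<close> is ever used; every form on the tangent plane extends this way.
\<close>

type_synonym metric = "real^3 \<Rightarrow> real^3 \<Rightarrow> real^3 \<Rightarrow> real"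

definition gram :: "metric \<Rightarrow> pole \<Rightarrow> real^2 \<Rightarrow> real^2^2" where
  "gram g s u = (\<chi> i j. g (stereo s u) (partial i (stereo s) u) (partial j (stereo s) u))"

definition riemannian_metric :: "metric \<Rightarrow> bool" where
  "riemannian_metric g \<longleftrightarrow>
     (\<forall>x\<in>S2. bilinear (g x) \<and>
        (\<forall>v\<in>tangent x. \<forall>w\<in>tangent x. g x v w = g x w v) \<and>
        (\<forall>v\<in>tangent x. v \<noteq> 0 \<longrightarrow> g x v v > 0)) \<and>
     (\<forall>s i j. smooth_on UNIV (\<lambda>u. gram g s u $ i $ j))"

text \<open>The omitted pole has measure zero, so one chart suffices for the volume measure.\<close>

definition vol :: "metric \<Rightarrow> (real^3) measure" where
  "vol g = distr (density lborel (\<lambda>u. ennreal (sqrt (det (gram g North u)))))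
             (restrict_space borel S2) (stereo North)"

definition christoffel :: "metric \<Rightarrow> pole \<Rightarrow> 2 \<Rightarrow> 2 \<Rightarrow> 2 \<Rightarrow> real^2 \<Rightarrow> real" where
  "christoffel g s m i j u =
     (\<Sum>l\<in>UNIV. matrix_inv (gram g s u) $ m $ l *
        (partial i (\<lambda>y. gram g s y $ j $ l) u + partial j (\<lambda>y. gram g s y $ i $ l) u
          - partial l (\<lambda>y. gram g s y $ i $ j) u)) / 2"

section \<open>Weak covariant derivatives\<close>

text \<open>
  A covariant tensor field of rank \<open>i\<close> with values in \<open>'w\<close> sends a point of the sphere and
  a list of \<open>i\<close> tangent vectors at that point to an element of \<open>'w\<close>.
\<close>

type_synonym 'w tensor_field = "real^3 \<Rightarrow> (real^3) list \<Rightarrow> 'w"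

definition tensor_field :: "nat \<Rightarrow> 'w::real_vector tensor_field \<Rightarrow> bool" where
  "tensor_field i T \<longleftrightarrow> (\<forall>x\<in>S2. multilinear_on (+) (*\<^sub>R) (tangent x) i (T x))"

definition component :: "pole \<Rightarrow> 'w tensor_field \<Rightarrow> 2 list \<Rightarrow> real^2 \<Rightarrow> 'w" where
  "component s T J u = T (stereo s u) (map (\<lambda>j. partial j (stereo s) u) J)"

text \<open>
  \<open>T'\<close> is the weak covariant derivative of the rank \<open>i\<close> tensor field \<open>T\<close> for the Levi-Civita
  connection: in both charts, weakly,
  \<open>\<partial>\<^sub>j T\<^sub>J = T'\<^bsub>j#J\<^esub> + \<Sum>\<^sub>l \<Sum>\<^sub>m \<Gamma>\<^sup>m\<^bsub>j,J!l\<^esub> T\<^bsub>J[l:=m]\<^esub>\<close>.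
\<close>

definition weak_cov_deriv ::
  "metric \<Rightarrow> nat \<Rightarrow> 'w::euclidean_space tensor_field \<Rightarrow> 'w tensor_field \<Rightarrow> bool" where
  "weak_cov_deriv g i T T' \<longleftrightarrow> tensor_field (Suc i) T' \<and>
     (\<forall>s j J. length J = i \<longrightarrow>
        weak_partial j (component s T J)
          (\<lambda>u. component s T' (j # J) u +
             (\<Sum>l<i. \<Sum>m\<in>UNIV. christoffel g s m j (J ! l) u *\<^sub>R component s T (J[l := m]) u)))"

text \<open>
  The \<open>i\<close>-th covariant derivative of \<open>f\<close>. Weak derivatives are unique up to null sets, and the
  choice made here has no influence beyond that; it is meaningful when the weak derivatives
  exist.
\<close>

primrec nabla ::
  "metric \<Rightarrow> (real^3 \<Rightarrow> 'w::euclidean_space) \<Rightarrow> nat \<Rightarrow> 'w tensor_field" where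
  "nabla g f 0 = (\<lambda>x vs. f x)"
| "nabla g f (Suc i) = (SOME T'. weak_cov_deriv g i (nabla g f i) T')"

definition orthonormal_frame :: "metric \<Rightarrow> real^3 \<Rightarrow> (2 \<Rightarrow> real^3) \<Rightarrow> bool" where
  "orthonormal_frame g x e \<longleftrightarrow>
     (\<forall>i. e i \<in> tangent x) \<and> (\<forall>i j. g x (e i) (e j) = (if i = j then 1 else 0))"

text \<open>The value does not depend on the choice of the orthonormal frame.\<close>

definition tensor_norm :: "metric \<Rightarrow> nat \<Rightarrow> real^3 \<Rightarrow> ((real^3) list \<Rightarrow> 'w::euclidean_space) \<Rightarrow> real" where
  "tensor_norm g i x t =
     (let e = (SOME e. orthonormal_frame g x e)
      in sqrt (\<Sum>J | length J = i. (norm (t (map e J)))\<^sup>2))"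

section \<open>Sobolev spaces on the two-sphere\<close>

definition sobolev_fun :: "metric \<Rightarrow> nat \<Rightarrow> nat \<Rightarrow> (real^3 \<Rightarrow> real^'m) set" where
  "sobolev_fun g k p = {f. f \<in> borel_measurable (vol g) \<and>
     (\<forall>i<k. \<exists>T'. weak_cov_deriv g i (nabla g f i) T') \<and>
     (\<forall>i\<le>k. integrable (vol g) (\<lambda>x. tensor_norm g i x (nabla g f i x) ^ p))}"

definition sobolev_energy :: "metric \<Rightarrow> nat \<Rightarrow> nat \<Rightarrow> (real^3 \<Rightarrow> real^'m) \<Rightarrow> real" where
  "sobolev_energy g k p f =
     (\<Sum>i\<le>k. LINT x|vol g. tensor_norm g i x (nabla g f i x) ^ p)"

text \<open>
  The Sobolev space consists of classes of functions modulo equality almost everywhere on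
  the sphere; in particular values off the sphere are irrelevant. The operations are defined
  through representatives.
\<close>

definition sobolev_class ::
  "metric \<Rightarrow> nat \<Rightarrow> nat \<Rightarrow> (real^3 \<Rightarrow> real^'m) \<Rightarrow> (real^3 \<Rightarrow> real^'m) set" where
  "sobolev_class g k p f = {h \<in> sobolev_fun g k p. AE x in vol g. h x = f x}"

definition sobolev_space :: "metric \<Rightarrow> nat \<Rightarrow> nat \<Rightarrow> (real^3 \<Rightarrow> real^'m) set set" where
  "sobolev_space g k p = sobolev_class g k p ` sobolev_fun g k p"

definition rep :: "'a set \<Rightarrow> 'a" where
  "rep F = (SOME f. f \<in> F)"

definition sobolev_add ::
  "metric \<Rightarrow> nat \<Rightarrow> nat \<Rightarrow> (real^3 \<Rightarrow> real^'m) set \<Rightarrow> (real^3 \<Rightarrow> real^'m) set \<Rightarrow> (real^3 \<Rightarrow> real^'m) set" where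
  "sobolev_add g k p F H = sobolev_class g k p (\<lambda>x. rep F x + rep H x)"

definition sobolev_scale ::
  "metric \<Rightarrow> nat \<Rightarrow> nat \<Rightarrow> real \<Rightarrow> (real^3 \<Rightarrow> real^'m) set \<Rightarrow> (real^3 \<Rightarrow> real^'m) set" where
  "sobolev_scale g k p c F = sobolev_class g k p (\<lambda>x. c *\<^sub>R rep F x)"

definition sobolev_norm :: "metric \<Rightarrow> nat \<Rightarrow> nat \<Rightarrow> (real^3 \<Rightarrow> real^'m) set \<Rightarrow> real" where
  "sobolev_norm g k p F = root p (sobolev_energy g k p (rep F))"

end

theory Submission
  imports Defs "HOL-Combinatorics.List_Permutation"
begin

text \<open>
  The function is the restriction to the diagonal of a bounded \<open>p\<close>-linear form, namely
  \<open>\<Sum>\<^sub>i \<integral> \<langle>\<nabla>\<^sup>i f\<^sub>1, \<nabla>\<^sup>i f\<^sub>2\<rangle> \<cdots> \<langle>\<nabla>\<^sup>i f\<^bsub>p-1\<^esub>, \<nabla>\<^sup>i f\<^sub>p\<rangle>\<close>, which is bounded by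
  Hoelder's inequality; such a restriction is a polynomial map and hence smooth. That the form is
  well defined and multilinear on classes of functions rests on the uniqueness of weak derivatives,
  that is, on the fundamental lemma of the calculus of variations. Measurability of the
  integrand is read off from the chart formula
  \<open>\<langle>S, T\<rangle> = \<Sum> g\<^bsup>KL\<^esup> S\<^sub>K \<cdot> T\<^sub>L\<close>, since the orthonormal frames are
  chosen without any regularity.
\<close>

section \<open>Diagonals of bounded multilinear forms\<close>

text \<open>Evenness of \<open>p\<close> makes the integrand polynomial: \<open>|T|^p\<close> is the
  \<open>p/2\<close>-th power of the quadratic form \<open><T, T>\<close>. What shapes the proof are
  the Hilbert choices. \<open>nabla\<close> picks each derivative by \<open>SOME\<close> among
  fields that agree only almost everywhere, and \<open>rep\<close> picks a representative of a
  class, so linearity of either is available only almost everywhere. Linearity is therefore stated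
  for any measurable function that is almost everywhere a combination of two others. Existence of
  its next derivative and the comparison with the combination of derivatives depend on each other
  and share one induction. Weak derivatives are tested in both charts whereas \<open>vol\<close>
  comes from the northern one, so null sets have to be carried across by the transition map. On the
  abstract side the order of the arguments matters, because the form pairs neighbours; averaging
  over permutations restores symmetry, and Frechet remainders are compared with those of the real
  polynomial \<open>(X + H) ^ n\<close>.\<close>

lemma multilinear_onD:
  assumes "multilinear_on add scl V n B" "length xs + 1 + length ys = n" "set xs \<subseteq> V" "set ys \<subseteq> V"
  shows multilinear_on_add: "v \<in> V \<Longrightarrow> w \<in> V \<Longrightarrow> B (xs @ add v w # ys) = B (xs @ v # ys) + B (xs @ w # ys)"
    and multilinear_on_scale: "v \<in> V \<Longrightarrow> B (xs @ scl c v # ys) = c *\<^sub>R B (xs @ v # ys)"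
  using assms unfolding multilinear_on_def by blast+

text \<open>Averaging leaves the diagonal unchanged and makes the order of the arguments irrelevant,
  so that derivatives of the diagonal can be written with the direction in front.\<close>

definition symmetrize :: "nat \<Rightarrow> ('v list \<Rightarrow> real) \<Rightarrow> 'v list \<Rightarrow> real" where
  "symmetrize n B vs = (\<Sum>\<pi> | \<pi> permutes {..<n}. B (permute_list \<pi> vs)) / fact n"

lemma symmetrize_cong_mset:
  assumes "mset xs = mset ys" "length ys = n"
  shows "symmetrize n B xs = symmetrize n B ys"
proof -
  obtain \<sigma> where \<sigma>: "\<sigma> permutes {..<n}" "permute_list \<sigma> ys = xs"
    using mset_eq_permutation[OF assms(1)] assms(2) by metis
  have "(\<Sum>\<pi> | \<pi> permutes {..<n}. B (permute_list \<pi> xs)) =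
        (\<Sum>\<pi> | \<pi> permutes {..<n}. B (permute_list (\<sigma> \<circ> \<pi>) ys))"
    using \<sigma> assms(2) by (intro sum.cong) (auto simp: permute_list_compose)
  also have "\<dots> = (\<Sum>\<pi> | \<pi> permutes {..<n}. B (permute_list \<pi> ys))"
    by (rule setum_permutations_compose_left[OF \<sigma>(1), symmetric])
  finally show ?thesis by (simp add: symmetrize_def)
qed

text \<open>Multilinearity speaks of one slot of a list, so a permuted list has to be exhibited with
  \<open>v\<close> in one slot again. It stands at the position that \<open>\<pi>\<close> sends to
  \<open>length xs\<close>, and its surroundings do not depend on \<open>v\<close>.\<close>

lemma permute_list_middle:
  assumes "\<pi> permutes {..<length xs + 1 + length ys}"
  obtains us ws where "\<And>v. permute_list \<pi> (xs @ v # ys) = us @ v # ws"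
    "length us + length ws = length xs + length ys" "set us \<union> set ws \<subseteq> set xs \<union> set ys"
proof -
  define q where "q = inv \<pi> (length xs)"
  let ?n = "length xs + 1 + length ys"
  have q: "\<pi> q = length xs" unfolding q_def using permutes_inverses[OF assms] by simp
  have qn: "q < ?n" unfolding q_def
    using permutes_in_image[OF permutes_inv[OF assms], of "length xs"] by simp
  have pi_lt: "\<pi> i < ?n" if "i < ?n" for i using permutes_in_image[OF assms, of i] that by simp
  have ne: "\<pi> i \<noteq> length xs" if "i \<noteq> q" for i
    using q that permutes_inj[OF assms] by (metis injD)
  define f where "f i = (if \<pi> i < length xs then xs ! \<pi> i else ys ! (\<pi> i - length xs - 1))" for i
  have f: "(xs @ v # ys) ! \<pi> i = f i" if "i \<noteq> q" for i v
    using ne[OF that] by (auto simp: f_def nth_append nth_Cons')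
  have fin: "f i \<in> set xs \<union> set ys" if "i \<noteq> q" "i < ?n" for i
    using ne[OF that(1)] pi_lt[OF that(2)] by (auto simp: f_def)
  have split: "[0..<?n] = [0..<q] @ q # [Suc q..<?n]"
    using qn by (metis less_imp_add_positive upt_conv_Cons upt_add_eq_append zero_order(1) less_imp_le_nat)
  show ?thesis
  proof (rule that[of "map f [0..<q]" "map f [Suc q..<?n]"])
    fix v
    have "permute_list \<pi> (xs @ v # ys) = map (\<lambda>i. (xs @ v # ys) ! \<pi> i) [0..<?n]"
      by (simp add: permute_list_def)
    also have "\<dots> = map f [0..<q] @ v # map f [Suc q..<?n]"
      unfolding split using f by (auto simp: q)
    finally show "permute_list \<pi> (xs @ v # ys) = map f [0..<q] @ v # map f [Suc q..<?n]" .
  next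
    show "length (map f [0..<q]) + length (map f [Suc q..<?n]) = length xs + length ys"
      unfolding length_map length_upt using qn by linarith
    show "set (map f [0..<q]) \<union> set (map f [Suc q..<?n]) \<subseteq> set xs \<union> set ys"
      unfolding set_map by (intro Un_least image_subsetI fin) (use qn in auto)
  qed
qed

lemma multilinear_on_symmetrize:
  assumes "multilinear_on add scl V n B"
  shows "multilinear_on add scl V n (symmetrize n B)"
  unfolding multilinear_on_def
proof (intro allI impI conjI ballI)
  fix xs ys :: "'a list" assume len: "length xs + 1 + length ys = n" and V: "set xs \<subseteq> V" "set ys \<subseteq> V"
  fix v assume v: "v \<in> V"
  have *: "B (permute_list \<pi> (xs @ add v w # ys)) = B (permute_list \<pi> (xs @ v # ys)) + B (permute_list \<pi> (xs @ w # ys))"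
    (is ?A)
    and **: "B (permute_list \<pi> (xs @ scl c v # ys)) = c *\<^sub>R B (permute_list \<pi> (xs @ v # ys))" (is ?B)
    if \<pi>: "\<pi> permutes {..<n}" and w: "w \<in> V" for \<pi> w c
  proof -
    obtain us ws where us: "\<And>v. permute_list \<pi> (xs @ v # ys) = us @ v # ws"
      "length us + length ws = length xs + length ys" "set us \<union> set ws \<subseteq> set xs \<union> set ys"
      using permute_list_middle[of \<pi> xs ys] \<pi> len by metis
    have *: "length us + 1 + length ws = n" "set us \<subseteq> V" "set ws \<subseteq> V" using us V len by auto
    show ?A ?B unfolding us(1)
      using multilinear_onD[OF assms *] v w by simp_all
  qed
  show "symmetrize n B (xs @ add v w # ys) = symmetrize n B (xs @ v # ys) + symmetrize n B (xs @ w # ys)"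
    if "w \<in> V" for w
    unfolding symmetrize_def using that by (simp add: * sum.distrib add_divide_distrib)
  show "symmetrize n B (xs @ scl c v # ys) = c *\<^sub>R symmetrize n B (xs @ v # ys)" for c
    unfolding symmetrize_def using v by (simp add: ** sum_distrib_left)
qed

text \<open>The product of the norms does not see the order, so each term of the average obeys the
  same bound and \<open>C\<close> survives.\<close>

lemma bounded_form_symmetrize:
  fixes B :: "'v list \<Rightarrow> real"
  assumes "bounded_form nrm V n C B"
  shows "bounded_form nrm V n C (symmetrize n B)"
  unfolding bounded_form_def
proof (intro allI impI)
  fix vs :: "'v list" assume vs: "length vs = n" "set vs \<subseteq> V"
  have "\<bar>B (permute_list \<pi> vs)\<bar> \<le> C * prod_list (map nrm vs)" if "\<pi> permutes {..<n}" for \<pi>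
  proof -
    have m: "mset (permute_list \<pi> vs) = mset vs" using that vs by simp
    have "\<bar>B (permute_list \<pi> vs)\<bar> \<le> C * prod_list (map nrm (permute_list \<pi> vs))"
      using assms vs m unfolding bounded_form_def
      by (metis mset_eq_setD size_mset)
    also have "prod_list (map nrm (permute_list \<pi> vs)) = prod_list (map nrm vs)"
      using m by (metis mset_map prod_mset_prod_list)
    finally show ?thesis .
  qed
  then have "\<bar>\<Sum>\<pi> | \<pi> permutes {..<n}. B (permute_list \<pi> vs)\<bar> \<le>
     (\<Sum>\<pi> | \<pi> permutes {..<n}. C * prod_list (map nrm vs))"
    by (intro order.trans[OF sum_abs] sum_mono) auto
  also have "\<dots> = fact n * (C * prod_list (map nrm vs))"
    by (simp add: card_permutations)
  finally show "\<bar>symmetrize n B vs\<bar> \<le> C * prod_list (map nrm vs)"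
    unfolding symmetrize_def by (simp add: field_simps abs_divide)
qed

lemma prod_list_map_nonneg: "(\<And>x. x \<in> set xs \<Longrightarrow> 0 \<le> (f x :: real)) \<Longrightarrow> 0 \<le> prod_list (map f xs)"
  by (induction xs) auto

text \<open>This is differentiability of \<open>c * X ^ n\<close> in one real variable. It supplies
  the little-o estimate for the multilinear remainder below.\<close>

lemma power_remainder_small:
  fixes X c \<epsilon> :: real
  assumes "\<epsilon> > 0"
  shows "\<exists>\<delta>>0. \<forall>H. 0 \<le> H \<longrightarrow> H < \<delta> \<longrightarrow> c * ((X + H) ^ n - X ^ n - n * H * X ^ (n - 1)) \<le> \<epsilon> * H"
proof -
  have "((\<lambda>x. c * x ^ n) has_real_derivative c * (n * X ^ (n - 1))) (at X)"
    by (auto intro!: derivative_eq_intros)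
  then have "((\<lambda>H. (c * (X + H) ^ n - c * X ^ n) / H) \<longlongrightarrow> c * (n * X ^ (n - 1))) (at 0)"
    by (simp add: DERIV_def)
  from tendstoD[OF this assms] obtain \<delta> where \<delta>: "\<delta> > 0"
    "\<And>H. H \<noteq> 0 \<Longrightarrow> \<bar>H\<bar> < \<delta> \<Longrightarrow> \<bar>(c * (X + H) ^ n - c * X ^ n) / H - c * (n * X ^ (n - 1))\<bar> < \<epsilon>"
    unfolding eventually_at dist_real_def by auto
  show ?thesis
  proof (intro exI[of _ \<delta>] conjI allI impI)
    fix H assume H: "0 \<le> H" "H < \<delta>"
    show "c * ((X + H) ^ n - X ^ n - n * H * X ^ (n - 1)) \<le> \<epsilon> * H"
    proof (cases "H = 0")
      case False
      then have "(c * (X + H) ^ n - c * X ^ n) / H - c * (n * X ^ (n - 1)) \<le> \<epsilon>"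
        using \<delta>(2)[of H] H by (simp add: abs_less_iff)
      then show ?thesis using False H by (simp add: field_simps)
    qed simp
  qed (rule \<delta>(1))
qed

text \<open>Expanding a multilinear form at \<open>x + h\<close> slot by slot follows the same
  combinatorics as expanding \<open>(X + H) ^ n\<close>. The remainder of the form is thus dominated
  by the numerical one at \<open>X = nrm x\<close>, \<open>H = nrm h\<close>.\<close>

lemma frechet_smooth_diagonal:
  fixes B :: "'v list \<Rightarrow> real"
  assumes closed: "\<And>x y. x \<in> V \<Longrightarrow> y \<in> V \<Longrightarrow> add x y \<in> V"
    and nn: "\<And>x. x \<in> V \<Longrightarrow> 0 \<le> nrm x"
    and B: "multilinear_on add scl V n B" "bounded_form nrm V n C B"
    and F: "\<And>x. x \<in> V \<Longrightarrow> F x = B (replicate n x)"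
  shows "frechet_smooth V add scl nrm F"
proof -
  define S where "S = symmetrize n B"
  \<comment> \<open>\<open>bounded_form\<close> does not force \<open>C\<close> to be nonnegative,
    but the monotonicity steps below need a nonnegative constant.\<close>
  define c where "c = \<bar>C\<bar>"
  have c: "c \<ge> 0" by (simp add: c_def)
  have ml: "multilinear_on add scl V n S" unfolding S_def by (rule multilinear_on_symmetrize[OF B(1)])
  have Sb: "\<bar>S vs\<bar> \<le> c * prod_list (map nrm vs)" if "length vs = n" "set vs \<subseteq> V" for vs
  proof -
    have "\<bar>S vs\<bar> \<le> C * prod_list (map nrm vs)"
      using bounded_form_symmetrize[OF B(2)] that unfolding S_def bounded_form_def by blast
    also have "\<dots> \<le> c * prod_list (map nrm vs)"
      unfolding c_def using that nn by (intro mult_right_mono prod_list_map_nonneg) auto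
    finally show ?thesis .
  qed
  have Ssym: "S xs = S ys" if "mset xs = mset ys" "length ys = n" for xs ys
    unfolding S_def by (rule symmetrize_cong_mset[OF that])
  have Sadd: "S (vs @ add x h # ws) = S (vs @ x # ws) + S (vs @ h # ws)"
    if "length vs + 1 + length ws = n" "set vs \<subseteq> V" "set ws \<subseteq> V" "x \<in> V" "h \<in> V" for vs ws x h
    by (rule multilinear_on_add[OF ml]) (use that in auto)
  \<comment> \<open>\<open>b0\<close>, \<open>b1\<close>, \<open>b2\<close> mirror
    \<open>(X + H) ^ m\<close>, the same without its constant term, and the same without its linear
    term too. Each copy of \<open>add x h\<close> is split by additivity, so
    \<open>nrm (add x h)\<close> never has to be estimated.\<close>
  have b0: "\<bar>S (vs @ replicate m (add x h))\<bar> \<le> c * prod_list (map nrm vs) * (nrm x + nrm h) ^ m"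
    if "length vs + m = n" "set vs \<subseteq> V" "x \<in> V" "h \<in> V" for vs m x h
    using that
  proof (induction m arbitrary: vs)
    case 0 then show ?case using Sb by simp
  next
    case (Suc m)
    have "\<bar>S ((vs @ [x]) @ replicate m (add x h))\<bar> \<le> c * prod_list (map nrm (vs @ [x])) * (nrm x + nrm h) ^ m"
      "\<bar>S ((vs @ [h]) @ replicate m (add x h))\<bar> \<le> c * prod_list (map nrm (vs @ [h])) * (nrm x + nrm h) ^ m"
      using Suc.prems by (intro Suc.IH; simp)+
    moreover have "S (vs @ add x h # replicate m (add x h)) =
       S (vs @ x # replicate m (add x h)) + S (vs @ h # replicate m (add x h))"
      using Suc.prems closed by (intro Sadd) auto
    ultimately show ?case by (simp add: algebra_simps)
  qed
  have b1: "\<bar>S (vs @ replicate m (add x h)) - S (vs @ replicate m x)\<bar>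
      \<le> c * prod_list (map nrm vs) * ((nrm x + nrm h) ^ m - nrm x ^ m)"
    if "length vs + m = n" "set vs \<subseteq> V" "x \<in> V" "h \<in> V" for vs m x h
    using that
  proof (induction m arbitrary: vs)
    case (Suc m)
    have "\<bar>S ((vs @ [x]) @ replicate m (add x h)) - S ((vs @ [x]) @ replicate m x)\<bar>
      \<le> c * prod_list (map nrm (vs @ [x])) * ((nrm x + nrm h) ^ m - nrm x ^ m)"
      using Suc.prems by (intro Suc.IH; simp)
    moreover have "\<bar>S ((vs @ [h]) @ replicate m (add x h))\<bar> \<le> c * prod_list (map nrm (vs @ [h])) * (nrm x + nrm h) ^ m"
      using Suc.prems by (intro b0; simp)
    moreover have "S (vs @ add x h # replicate m (add x h)) =
       S (vs @ x # replicate m (add x h)) + S (vs @ h # replicate m (add x h))"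
      using Suc.prems closed by (intro Sadd) auto
    ultimately show ?case by (simp add: algebra_simps)
  qed simp
  \<comment> \<open>Splitting one slot, the part with \<open>x\<close> is a remainder of the same
    kind with smaller \<open>m\<close>, while the part with \<open>h\<close> has already gained a
    factor \<open>nrm h\<close>, so that \<open>b1\<close> suffices for it.\<close>
  have b2: "\<bar>S (vs @ replicate m (add x h)) - S (vs @ replicate m x) - m * S (h # vs @ replicate (m - 1) x)\<bar>
      \<le> c * prod_list (map nrm vs) * ((nrm x + nrm h) ^ m - nrm x ^ m - m * nrm h * nrm x ^ (m - 1))"
    if "length vs + m = n" "set vs \<subseteq> V" "x \<in> V" "h \<in> V" for vs m x h
    using that
  proof (induction m arbitrary: vs)
    case (Suc m)
    have IH1: "\<bar>S ((vs @ [x]) @ replicate m (add x h)) - S ((vs @ [x]) @ replicate m x) - m * S (h # (vs @ [x]) @ replicate (m - 1) x)\<bar>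
      \<le> c * prod_list (map nrm (vs @ [x])) * ((nrm x + nrm h) ^ m - nrm x ^ m - m * nrm h * nrm x ^ (m - 1))"
      using Suc.prems by (intro Suc.IH; simp)
    have IH2: "\<bar>S ((vs @ [h]) @ replicate m (add x h)) - S ((vs @ [h]) @ replicate m x)\<bar>
      \<le> c * prod_list (map nrm (vs @ [h])) * ((nrm x + nrm h) ^ m - nrm x ^ m)"
      using Suc.prems by (intro b1; simp)
    \<comment> \<open>For \<open>m = 0\<close> the truncated \<open>m - 1\<close> makes the two
      lists differ, but the coefficient is zero.\<close>
    have "m * S (h # (vs @ [x]) @ replicate (m - 1) x) = m * S (h # vs @ replicate m x)"
      by (cases m) auto
    \<comment> \<open>Symmetry brings \<open>h\<close> from behind \<open>vs\<close> to the
      front.\<close>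
    moreover have "S ((vs @ [h]) @ replicate m x) = S (h # vs @ replicate m x)"
      using Suc.prems by (intro Ssym) auto
    moreover have "S (vs @ add x h # replicate m (add x h)) =
       S (vs @ x # replicate m (add x h)) + S (vs @ h # replicate m (add x h))"
      using Suc.prems closed by (intro Sadd) auto
    moreover from this have "S (vs @ replicate (Suc m) (add x h)) =
       S ((vs @ [x]) @ replicate m (add x h)) + S ((vs @ [h]) @ replicate m (add x h))"
      by simp
    moreover have "S (vs @ replicate (Suc m) x) = S ((vs @ [x]) @ replicate m x)"
      by simp
    moreover have "Suc m * S (h # vs @ replicate m x) = m * S (h # vs @ replicate m x) + S (h # vs @ replicate m x)"
      by (simp add: distrib_right)
    ultimately have eq: "S (vs @ replicate (Suc m) (add x h)) - S (vs @ replicate (Suc m) x) - Suc m * S (h # vs @ replicate m x) =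
      (S ((vs @ [x]) @ replicate m (add x h)) - S ((vs @ [x]) @ replicate m x) - m * S (h # (vs @ [x]) @ replicate (m - 1) x))
      + (S ((vs @ [h]) @ replicate m (add x h)) - S ((vs @ [h]) @ replicate m x))"
      by linarith
    have "\<bar>S (vs @ replicate (Suc m) (add x h)) - S (vs @ replicate (Suc m) x) - Suc m * S (h # vs @ replicate m x)\<bar>
      \<le> c * prod_list (map nrm (vs @ [x])) * ((nrm x + nrm h) ^ m - nrm x ^ m - m * nrm h * nrm x ^ (m - 1))
        + c * prod_list (map nrm (vs @ [h])) * ((nrm x + nrm h) ^ m - nrm x ^ m)"
      unfolding eq using IH1 IH2 by linarith
    also have "\<dots> = c * prod_list (map nrm vs) *
       (nrm x * ((nrm x + nrm h) ^ m - nrm x ^ m) - m * nrm h * nrm x ^ (m - 1) * nrm x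
          + nrm h * ((nrm x + nrm h) ^ m - nrm x ^ m))"
      by (simp add: algebra_simps)
    also have "m * nrm h * nrm x ^ (m - 1) * nrm x = m * nrm h * nrm x ^ m"
      by (cases m) auto
    finally show ?case by (simp add: algebra_simps)
  qed simp
  \<comment> \<open>The \<open>j\<close>-th derivative of \<open>S (x, ..., x)\<close>:
    \<open>n! / (n - j)!\<close> counts the ways to place \<open>j\<close> directions in
    \<open>n\<close> slots, and beyond degree \<open>n\<close> everything vanishes.\<close>
  define D where "D j x vs = (if j \<le> n then fact n / fact (n - j) * S (vs @ replicate (n - j) x) else 0)"
    for j x vs
  have S_diag: "S (replicate n x) = B (replicate n x)" for x
  proof -
    have "permute_list \<pi> (replicate n x) = replicate n x" if "\<pi> permutes {..<n}" for \<pi>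
      using that permutes_in_image[OF that]
      by (intro nth_equalityI) (auto simp: permute_list_nth)
    then show ?thesis unfolding S_def symmetrize_def by (simp add: card_permutations)
  qed
  show ?thesis unfolding frechet_smooth_def
  proof (intro exI[of _ D] conjI ballI allI impI)
    show "D 0 x [] = F x" if "x \<in> V" for x
      using F[OF that] S_diag by (simp add: D_def)
    show "multilinear_on add scl V j (D j x)" if x: "x \<in> V" for j x
      unfolding multilinear_on_def
    proof (intro allI impI conjI ballI)
      fix xs ys v assume 1: "length xs + 1 + length ys = j" "set xs \<subseteq> V" "set ys \<subseteq> V" "v \<in> V"
      have *: "S (xs @ add v w # ys @ replicate (n - j) x) = S (xs @ v # ys @ replicate (n - j) x) + S (xs @ w # ys @ replicate (n - j) x)"
        if "w \<in> V" "j \<le> n" for w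
        using 1 that x by (intro multilinear_onD[OF ml]) auto
      have **: "S (xs @ scl a v # ys @ replicate (n - j) x) = a *\<^sub>R S (xs @ v # ys @ replicate (n - j) x)"
        if "j \<le> n" for a
        using 1 that x by (intro multilinear_onD[OF ml]) auto
      show "D j x (xs @ add v w # ys) = D j x (xs @ v # ys) + D j x (xs @ w # ys)" if "w \<in> V" for w
        using *[OF that] by (simp add: D_def distrib_left add_divide_distrib)
      show "D j x (xs @ scl a v # ys) = a *\<^sub>R D j x (xs @ v # ys)" for a
        using ** by (simp add: D_def)
    qed
    show "\<exists>C. bounded_form nrm V j C (D j x)" if x: "x \<in> V" for j x
    proof (intro exI[of _ "fact n / fact (n - j) * c * nrm x ^ (n - j)"], unfold bounded_form_def, intro allI impI)
      fix vs assume vs: "length vs = j" "set vs \<subseteq> V"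
      show "\<bar>D j x vs\<bar> \<le> fact n / fact (n - j) * c * nrm x ^ (n - j) * prod_list (map nrm vs)"
      proof (cases "j \<le> n")
        case True
        have "\<bar>S (vs @ replicate (n - j) x)\<bar> \<le> c * prod_list (map nrm (vs @ replicate (n - j) x))"
          using vs True x by (intro Sb) auto
        then have "fact n / fact (n - j) * \<bar>S (vs @ replicate (n - j) x)\<bar> \<le>
          fact n / fact (n - j) * (c * prod_list (map nrm (vs @ replicate (n - j) x)))"
          by (intro mult_left_mono) auto
        then show ?thesis using True by (simp add: D_def abs_mult algebra_simps)
      next
        case False
        then show ?thesis using c nn x vs by (auto simp: D_def intro!: mult_nonneg_nonneg prod_list_map_nonneg zero_le_power)
      qed
    qed
    show "\<exists>\<delta>>0. \<forall>h\<in>V. nrm h < \<delta> \<longrightarrow> bounded_form nrm V j (\<epsilon> * nrm h)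
             (\<lambda>vs. D j (add x h) vs - D j x vs - D (Suc j) x (h # vs))"
      if x: "x \<in> V" and \<epsilon>: "\<epsilon> > 0" for j x \<epsilon>
    proof (cases "j \<le> n")
      case True
      define m where "m = n - j"
      define a where "a = (fact n / fact m :: real)"
      have a: "a \<ge> 0" by (simp add: a_def)
      obtain \<delta> where \<delta>: "\<delta> > 0" "\<forall>H::real. 0 \<le> H \<longrightarrow> H < \<delta> \<longrightarrow>
           (a * c) * ((nrm x + H) ^ m - nrm x ^ m - m * H * nrm x ^ (m - 1)) \<le> \<epsilon> * H"
        using power_remainder_small[OF \<epsilon>, of "a * c" "nrm x" m] by (elim exE conjE)
      have "bounded_form nrm V j (\<epsilon> * nrm h) (\<lambda>vs. D j (add x h) vs - D j x vs - D (Suc j) x (h # vs))"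
        if h: "h \<in> V" "nrm h < \<delta>" for h
        unfolding bounded_form_def
      proof (intro allI impI)
        fix vs assume vs: "length vs = j" "set vs \<subseteq> V"
        have P: "prod_list (map nrm vs) \<ge> 0" using vs nn by (intro prod_list_map_nonneg) auto
        \<comment> \<open>\<open>Suc j\<close> exceeds \<open>n\<close> exactly when
          \<open>m = 0\<close>, and then the factor \<open>m\<close> annihilates the right-hand
          side.\<close>
        have D': "D (Suc j) x (h # vs) = a * (m * S (h # vs @ replicate (m - 1) x))"
        proof (cases m)
          case 0 then show ?thesis using True by (simp add: D_def m_def)
        next
          case (Suc m')
          then have "Suc j \<le> n" "n - Suc j = m'" by (auto simp: m_def)
          then show ?thesis using Suc by (simp add: D_def a_def field_simps del: of_nat_Suc)
        qed
        have "\<bar>D j (add x h) vs - D j x vs - D (Suc j) x (h # vs)\<bar> =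
           a * \<bar>S (vs @ replicate m (add x h)) - S (vs @ replicate m x) - m * S (h # vs @ replicate (m - 1) x)\<bar>"
          unfolding D' using True a by (simp add: D_def m_def[symmetric] a_def[symmetric] abs_mult right_diff_distrib[symmetric])
        also have "\<dots> \<le> a * (c * prod_list (map nrm vs) * ((nrm x + nrm h) ^ m - nrm x ^ m - m * nrm h * nrm x ^ (m - 1)))"
          using vs x h True a by (intro mult_left_mono b2) (auto simp: m_def)
        also have "\<dots> = (a * c) * ((nrm x + nrm h) ^ m - nrm x ^ m - m * nrm h * nrm x ^ (m - 1)) * prod_list (map nrm vs)"
          by (simp add: algebra_simps)
        also have "\<dots> \<le> \<epsilon> * nrm h * prod_list (map nrm vs)"
          using \<delta>(2)[rule_format, of "nrm h"] h nn P by (intro mult_right_mono) auto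
        finally show "\<bar>D j (add x h) vs - D j x vs - D (Suc j) x (h # vs)\<bar> \<le> \<epsilon> * nrm h * prod_list (map nrm vs)" .
      qed
      then show ?thesis using \<delta>(1) by blast
    next
      case False
      have "bounded_form nrm V j (\<epsilon> * nrm h) (\<lambda>vs. D j (add x h) vs - D j x vs - D (Suc j) x (h # vs))"
        if h: "h \<in> V" for h
        unfolding bounded_form_def
      proof (intro allI impI)
        fix vs assume vs: "length vs = j" "set vs \<subseteq> V"
        have "0 \<le> \<epsilon> * nrm h * prod_list (map nrm vs)"
          using h vs nn \<epsilon> by (intro mult_nonneg_nonneg prod_list_map_nonneg) auto
        then show "\<bar>D j (add x h) vs - D j x vs - D (Suc j) x (h # vs)\<bar> \<le> \<epsilon> * nrm h * prod_list (map nrm vs)"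
          using False by (simp add: D_def)
      qed
      then show ?thesis using zero_less_one by blast
    qed
  qed
qed

section \<open>The fundamental lemma of the calculus of variations\<close>

text \<open>The classical flat function \<open>exp (-1/t)\<close>, extended by zero. The powers of
  \<open>1/t\<close> are included so that derivatives are linear combinations of members of the
  family.\<close>

definition flat_exp :: "nat \<Rightarrow> real \<Rightarrow> real" where
  "flat_exp m t = (if t > 0 then exp (- 1 / t) / t ^ m else 0)"

lemma tendsto_flat_exp_0: "((\<lambda>t. exp (- 1 / t) / t ^ m) \<longlongrightarrow> (0::real)) (at_right 0)"
proof -
  have "((\<lambda>s. s ^ m / exp s) \<longlongrightarrow> (0::real)) at_top"
    by (rule tendsto_power_div_exp_0)
  then have "((\<lambda>t. inverse t ^ m / exp (inverse t)) \<longlongrightarrow> (0::real)) (at_right 0)"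
    by (rule filterlim_compose[OF _ filterlim_inverse_at_top_right])
  then show ?thesis
    by (simp add: exp_minus field_simps)
qed

lemma flat_exp_has_derivative:
  "(flat_exp m has_real_derivative flat_exp (m + 2) t - m * flat_exp (m + 1) t) (at t)"
proof (cases t "0::real" rule: linorder_cases)
  case less
  have "((\<lambda>_. 0::real) has_real_derivative 0) (at t)" by simp
  then have "(flat_exp m has_real_derivative 0) (at t)"
    by (rule has_field_derivative_transform_within_open[of _ _ _ "{..<0}"])
       (use less in \<open>auto simp: flat_exp_def\<close>)
  then show ?thesis using less by (simp add: flat_exp_def)
next
  case equal
  \<comment> \<open>At 0 the difference quotient is \<open>flat_exp (Suc m)\<close> on the right and
    zero on the left; both one-sided limits are 0.\<close>
  have "((\<lambda>h. flat_exp m h / h) \<longlongrightarrow> 0) (at_right 0)"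
    by (rule Lim_transform_eventually[OF tendsto_flat_exp_0[of "Suc m"]])
       (auto simp: flat_exp_def eventually_at_right_less field_simps intro!: eventually_mono[OF eventually_at_right_less])
  moreover have "((\<lambda>h. flat_exp m h / h) \<longlongrightarrow> 0) (at_left 0)"
    by (rule Lim_transform_eventually[OF tendsto_const])
       (auto simp: flat_exp_def eventually_at_filter)
  ultimately have "((\<lambda>h. flat_exp m h / h) \<longlongrightarrow> 0) (at 0)"
    by (simp add: filterlim_split_at_real)
  then show ?thesis using equal by (simp add: DERIV_def flat_exp_def)
next
  case greater
  have "((\<lambda>t. exp (- 1 / t) / t ^ m) has_real_derivative flat_exp (m + 2) t - m * flat_exp (m + 1) t) (at t)"
  proof (cases m)
    case 0
    then show ?thesis using greater
      by (auto intro!: derivative_eq_intros simp: flat_exp_def power2_eq_square)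
  next
    case (Suc k)
    then show ?thesis using greater
      by (auto intro!: derivative_eq_intros simp: flat_exp_def power2_eq_square power_add divide_simps)
         (cases k; simp add: algebra_simps)
  qed
  then show ?thesis
    by (rule has_field_derivative_transform_within_open[of _ _ _ "{0<..}"])
       (use greater in \<open>auto simp: flat_exp_def\<close>)
qed

text \<open>Closed under directional derivatives, hence consisting of smooth functions.\<close>

inductive elementary :: "('a::euclidean_space \<Rightarrow> real) \<Rightarrow> bool" where
  const: "elementary (\<lambda>_. c)"
| flat: "elementary (\<lambda>x. flat_exp m (x \<bullet> v + c))"
| add: "elementary f \<Longrightarrow> elementary h \<Longrightarrow> elementary (\<lambda>x. f x + h x)"
| mult: "elementary f \<Longrightarrow> elementary h \<Longrightarrow> elementary (\<lambda>x. f x * h x)"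
| exp: "elementary f \<Longrightarrow> elementary (\<lambda>x. exp (f x))"

text \<open>For each fixed direction the derivative is again elementary as a function of the point,
  which is exactly what the recursion of \<open>Ck_on\<close> asks for.\<close>

lemma elementary_has_derivative:
  assumes "elementary f"
  shows "\<exists>f'. (\<forall>x. (f has_derivative f' x) (at x)) \<and> (\<forall>v. elementary (\<lambda>x. f' x v))"
  using assms
proof induction
  case (const c)
  show ?case by (rule exI[of _ "\<lambda>x v. 0"]) (auto intro: elementary.const)
next
  case (flat m w c)
  have d: "((\<lambda>x. flat_exp m (x \<bullet> w + c)) has_derivative
     (\<lambda>v. (v \<bullet> w) * (flat_exp (m + 2) (x \<bullet> w + c) + (- m) * flat_exp (m + 1) (x \<bullet> w + c)))) (at x)" for x
  proof -
    have "((\<lambda>x. x \<bullet> w + c) has_derivative (\<lambda>v. v \<bullet> w)) (at x)"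
      by (auto intro!: derivative_eq_intros)
    from has_derivative_compose[OF this flat_exp_has_derivative[of m, unfolded has_field_derivative_def]]
    show ?thesis by (simp add: mult.commute)
  qed
  show ?case
    by (rule exI, intro conjI allI, rule d) (intro elementary.intros)
next
  case (add f h)
  then obtain f' h' where "\<And>x. (f has_derivative f' x) (at x)" "\<And>v. elementary (\<lambda>x. f' x v)"
    "\<And>x. (h has_derivative h' x) (at x)" "\<And>v. elementary (\<lambda>x. h' x v)" by blast
  then show ?case
    by (intro exI[of _ "\<lambda>x v. f' x v + h' x v"]) (auto intro!: derivative_intros elementary.intros)
next
  case (mult f h)
  then obtain f' h' where "\<And>x. (f has_derivative f' x) (at x)" "\<And>v. elementary (\<lambda>x. f' x v)"
    "\<And>x. (h has_derivative h' x) (at x)" "\<And>v. elementary (\<lambda>x. h' x v)" by blast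
  then show ?case using mult.hyps
    by (intro exI[of _ "\<lambda>x v. f x * h' x v + f' x v * h x"]) (auto intro!: derivative_intros elementary.intros)
next
  case (exp f)
  then obtain f' where f': "\<And>x. (f has_derivative f' x) (at x)" "\<And>v. elementary (\<lambda>x. f' x v)" by blast
  then have "((\<lambda>x. exp (f x)) has_derivative (\<lambda>v. exp (f x) * f' x v)) (at x)" for x
    by (auto intro!: derivative_eq_intros)
  then show ?case using f' exp.hyps
    by (intro exI[of _ "\<lambda>x v. exp (f x) * f' x v"]) (auto intro!: elementary.intros)
qed

lemma elementary_smooth_on: "elementary f \<Longrightarrow> smooth_on UNIV f"
proof -
  have "elementary f \<Longrightarrow> Ck_on n UNIV f" for n
  proof (induction n arbitrary: f)
    case 0
    then obtain f' where "\<And>x. (f has_derivative f' x) (at x)"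
      using elementary_has_derivative by blast
    then show ?case
      unfolding Ck_on.simps by (rule has_derivative_continuous_on)
  next
    case (Suc n)
    obtain f' where f': "\<And>x. (f has_derivative f' x) (at x)" "\<And>v. elementary (\<lambda>x. f' x v)"
      using elementary_has_derivative[OF Suc.prems] by blast
    have "frechet_derivative f (at x) = f' x" for x
      by (rule frechet_derivative_at[OF f'(1), symmetric])
    then have "Ck_on n UNIV (\<lambda>x. frechet_derivative f (at x) v)" for v
      using Suc.IH[OF f'(2)] by simp
    moreover have "f differentiable (at x)" for x
      using f'(1) unfolding differentiable_def by blast
    ultimately show ?case by simp
  qed
  then show "elementary f \<Longrightarrow> smooth_on UNIV f" by (simp add: smooth_on_def)
qed

lemma elementary_prod: "(\<And>i. i \<in> I \<Longrightarrow> elementary (f i)) \<Longrightarrow> elementary (\<lambda>x. \<Prod>i\<in>I. f i x)"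
  by (induction I rule: infinite_finite_induct) (auto intro: elementary.intros)

text \<open>\<open>H\<close> is a smooth function that is positive on the box and zero outside, and
  \<open>1 - exp (- n H)\<close> then increases to the indicator of the box. The bound by 1 prepares
  dominated convergence.\<close>

lemma test_functions_approximate_box:
  fixes a b :: "real^2"
  obtains \<phi> where "\<And>n. test_function (\<phi> n)" "\<And>n x. 0 \<le> \<phi> n x \<and> \<phi> n x \<le> 1"
    "\<And>n x. x \<notin> box a b \<Longrightarrow> \<phi> n x = 0" "\<And>x. (\<lambda>n. \<phi> n x) \<longlonglongrightarrow> indicator (box a b) x"
proof -
  define H where "H x = (\<Prod>i\<in>Basis. flat_exp 0 (x \<bullet> i + - (a \<bullet> i)) * flat_exp 0 (x \<bullet> (- i) + b \<bullet> i))"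
    for x :: "real^2"
  define \<phi> where "\<phi> n x = 1 + (- 1) * exp ((- real n) * H x)" for n x
  have H0: "H x \<ge> 0" for x unfolding H_def by (intro prod_nonneg) (auto simp: flat_exp_def)
  have Hout: "H x = 0" if x: "x \<notin> box a b" for x
  proof -
    obtain i where i: "i \<in> Basis" "\<not> (a \<bullet> i < x \<bullet> i \<and> x \<bullet> i < b \<bullet> i)"
      using x unfolding mem_box by blast
    then show ?thesis unfolding H_def
      by (intro prod_zero finite_Basis bexI[OF _ i(1)]) (auto simp: flat_exp_def)
  qed
  have Hin: "H x > 0" if "x \<in> box a b" for x
    using that unfolding H_def by (intro prod_pos) (auto simp: flat_exp_def mem_box not_less)
  have "elementary H" unfolding H_def by (intro elementary_prod elementary.intros)
  then have el: "elementary (\<phi> n)" for n unfolding \<phi>_def by (intro elementary.intros)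
  show ?thesis
  proof (rule that)
    show "0 \<le> \<phi> n x \<and> \<phi> n x \<le> 1" for n x using H0[of x] by (simp add: \<phi>_def)
    show out: "\<phi> n x = 0" if "x \<notin> box a b" for n x using Hout[OF that] by (simp add: \<phi>_def)
    show "test_function (\<phi> n)" for n
      unfolding test_function_def
      using elementary_smooth_on[OF el] out box_subset_cbox by (metis compact_cbox subsetD)
    show "(\<lambda>n. \<phi> n x) \<longlonglongrightarrow> indicator (box a b) x" for x
    proof (cases "x \<in> box a b")
      case True
      have "norm (exp (- H x)) < 1" using Hin[OF True] by simp
      then have "norm (exp (- H x)) < 1" using Hin[OF True] by simp
      then have "(\<lambda>n. exp (- H x) ^ n) \<longlonglongrightarrow> 0" by (rule LIMSEQ_power_zero)
      then have "(\<lambda>n. 1 - exp (- H x) ^ n) \<longlonglongrightarrow> 1 - 0" by (rule tendsto_diff[OF tendsto_const])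
      then show ?thesis using True by (simp add: \<phi>_def exp_of_nat_mult[symmetric])
    qed (simp add: out)
  qed
qed

lemma locally_integrable_measurable:
  fixes u :: "real^2 \<Rightarrow> 'b::euclidean_space"
  assumes "locally_integrable u"
  shows "u \<in> borel_measurable borel"
proof -
  have "set_borel_measurable lborel (cball 0 (real n)) u" for n
    using assms unfolding locally_integrable_def
    by (meson compact_cball set_integrable_def set_borel_measurable_def borel_measurable_integrable)
  then have "(\<lambda>x. indicator (cball 0 (real n)) x *\<^sub>R u x) \<in> borel_measurable borel" for n
    by (simp add: set_borel_measurable_def)
  then show ?thesis
  proof (rule borel_measurable_LIMSEQ_metric)
    fix x :: "real^2"
    obtain N where N: "norm x \<le> real N" using real_arch_simple by blast
    have "\<forall>\<^sub>F n in sequentially. indicator (cball 0 (real n)) x *\<^sub>R u x = u x"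
      using eventually_ge_at_top[of N] by eventually_elim (use N in auto)
    then show "(\<lambda>n. indicator (cball 0 (real n)) x *\<^sub>R u x) \<longlonglongrightarrow> u x"
      by (rule tendsto_eventually)
  qed
qed

text \<open>A pi-lambda argument: boxes are stable under intersection and generate the Borel sets,
  so the integral vanishes over every Borel set. The whole space is not a box, and
  \<open>whole\<close> provides the complement step.\<close>

lemma integral_box_zero_imp_AE_zero:
  fixes f :: "'a::euclidean_space \<Rightarrow> real"
  assumes f: "integrable lborel f"
    and 0: "\<And>a b. (LINT x:box a b|lborel. f x) = 0" and whole: "(LINT x|lborel. f x) = 0"
  shows "AE x in lborel. f x = 0"
proof (rule density_unique_real[OF f integrable_zero])
  fix A :: "'a set" assume "A \<in> sets lborel"
  then have "A \<in> sets borel" by simp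
  have "Int_stable (range (\<lambda>(a, b). box a b :: 'a set))"
    by (auto simp: Int_stable_def box_Int_box)
  moreover have "range (\<lambda>(a, b). box a b :: 'a set) \<subseteq> Pow UNIV" by auto
  moreover from \<open>A \<in> sets borel\<close> have "A \<in> sigma_sets UNIV (range (\<lambda>(a, b). box a b))" unfolding borel_eq_box by simp
  ultimately have "(LINT x:A|lborel. f x) = 0"
  proof (induction rule: sigma_sets_induct_disjoint)
    case (basic A) then show ?case using 0 by auto
  next
    case empty show ?case by (simp add: set_lebesgue_integral_def)
  next
    case (compl A)
    then have A[measurable]: "A \<in> sets borel" by (simp add: borel_eq_box)
    have "(LINT x:A \<union> (UNIV - A)|lborel. f x) = (LINT x:A|lborel. f x) + (LINT x:UNIV - A|lborel. f x)"
      using integrable_mult_indicator[OF _ f, of A] integrable_mult_indicator[OF _ f, of "UNIV - A"]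
      by (intro set_integral_Un) (auto simp: set_integrable_def)
    moreover have "A \<union> (UNIV - A) = UNIV" by auto
    ultimately show ?case using whole compl by (simp add: set_lebesgue_integral_def)
  next
    case (union F)
    then have F: "\<And>i. F i \<in> sets lborel" by (simp add: borel_eq_box subset_eq)
    have "(LINT x:(\<Union>i. F i)|lborel. f x) = (\<Sum>i. (LINT x:F i|lborel. f x))"
      using union F integrable_mult_indicator[OF _ f, of "\<Union>i. F i"]
      by (intro lebesgue_integral_countable_add)
         (auto simp: set_integrable_def disjoint_family_on_def)
    then show ?case using union by simp
  qed
  then show "(LINT x:A|lborel. f x) = (LINT x:A|lborel. 0)" by simp
qed

text \<open>Passing to the limit in the test functions shows that \<open>w\<close> integrates to
  zero over boxes. Since \<open>w\<close> is only locally integrable, each coordinate is cut off to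
  a box before the pi-lambda argument, and countably many boxes exhaust the plane.\<close>

lemma test_function_integral_zero_imp_AE_zero:
  fixes w :: "real^2 \<Rightarrow> 'b::euclidean_space"
  assumes w: "locally_integrable w"
    and 0: "\<And>\<phi>. test_function \<phi> \<Longrightarrow> (LINT x|lborel. \<phi> x *\<^sub>R w x) = 0"
  shows "AE x in lborel. w x = 0"
proof -
  have m[measurable]: "w \<in> borel_measurable borel" by (rule locally_integrable_measurable[OF w])
  have int: "integrable lborel (\<lambda>x. indicator (cbox a b) x *\<^sub>R w x)" for a b
    using w compact_cbox unfolding locally_integrable_def set_integrable_def by blast
  have intb: "integrable lborel (\<lambda>x. indicator (box a b) x *\<^sub>R w x)" for a b
    using int[of a b] by (rule Bochner_Integration.integrable_bound)
      (auto simp: indicator_def dest: box_subset_cbox[THEN subsetD])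
  have box: "(LINT x|lborel. indicator (box a b) x *\<^sub>R w x) = 0" for a b
  proof -
    obtain \<phi> where \<phi>: "\<And>n. test_function (\<phi> n)" "\<And>n x. 0 \<le> \<phi> n x \<and> \<phi> n x \<le> 1"
    "\<And>n x. x \<notin> box a b \<Longrightarrow> \<phi> n x = 0" "\<And>x. (\<lambda>n. \<phi> n x) \<longlonglongrightarrow> indicator (box a b) x"
      using test_functions_approximate_box[of a b] by blast
    have [measurable]: "\<phi> n \<in> borel_measurable borel" for n
    proof -
      have "Ck_on 0 UNIV (\<phi> n)" using \<phi>(1) unfolding test_function_def smooth_on_def by blast
      then show ?thesis by (simp add: borel_measurable_continuous_onI)
    qed
    have "(\<lambda>n. LINT x|lborel. \<phi> n x *\<^sub>R w x) \<longlonglongrightarrow> (LINT x|lborel. indicator (box a b) x *\<^sub>R w x)"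
    proof (rule integral_dominated_convergence)
      show "integrable lborel (\<lambda>x. norm (indicator (cbox a b) x *\<^sub>R w x))"
        by (rule integrable_norm[OF int])
      show "AE x in lborel. (\<lambda>n. \<phi> n x *\<^sub>R w x) \<longlonglongrightarrow> indicator (box a b) x *\<^sub>R w x"
        by (intro AE_I2 tendsto_intros \<phi>)
      have "norm (\<phi> n x *\<^sub>R w x) \<le> norm (indicator (cbox a b) x *\<^sub>R w x)" for n x
        using \<phi>(2)[of n x] \<phi>(3)[of x n] box_subset_cbox[of a b]
        by (cases "x \<in> box a b") (auto simp: mult_left_le_one_le)
      then show "AE x in lborel. norm (\<phi> n x *\<^sub>R w x) \<le> norm (indicator (cbox a b) x *\<^sub>R w x)" for n
        by auto
    qed auto
    then show ?thesis using 0[OF \<phi>(1)] by (simp add: LIMSEQ_const_iff)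
  qed
  \<comment> \<open>Two boxes meet in a box, so the cut-off coordinate still has zero integral over
    every box.\<close>
  have comp: "AE x in lborel. indicator (box a b) x * (w x \<bullet> e) = 0" for a b and e
  proof (rule integral_box_zero_imp_AE_zero)
    have *: "indicator (box c d) x * (indicator (box a b) x * (w x \<bullet> e)) =
       (indicator (box (\<Sum>i\<in>Basis. max (a \<bullet> i) (c \<bullet> i) *\<^sub>R i) (\<Sum>i\<in>Basis. min (b \<bullet> i) (d \<bullet> i) *\<^sub>R i)) x *\<^sub>R w x) \<bullet> e"
      for c d x
      unfolding box_Int_box[symmetric] by (simp add: indicator_inter_arith algebra_simps)
    show "integrable lborel (\<lambda>x. indicator (box a b) x * (w x \<bullet> e))"
      using integrable_inner_left[OF intb[of a b], of e] by simp
    show "(LINT x|lborel. indicator (box a b) x * (w x \<bullet> e)) = 0"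
      using integral_inner_left[OF intb[of a b], of e] box by simp
    show "(LINT x:box c d|lborel. indicator (box a b) x * (w x \<bullet> e)) = 0" for c d
      unfolding set_lebesgue_integral_def real_scaleR_def * using integral_inner_left[OF intb] box by simp
  qed
  have "AE x in lborel. \<forall>n. \<forall>e\<in>Basis. indicator (box (- (real n *\<^sub>R One)) (real n *\<^sub>R One)) x * (w x \<bullet> e) = 0"
    unfolding AE_all_countable AE_finite_all[OF finite_Basis] by (intro allI ballI comp)
  then show ?thesis
  proof eventually_elim
    case (elim x)
    obtain n where n: "x \<in> box (- (real n *\<^sub>R One)) (real n *\<^sub>R One)"
      using UN_box_eq_UNIV by blast
    have "w x \<bullet> e = 0" if "e \<in> Basis" for e
      using elim[rule_format, OF that, of n] n by simp
    then show ?case using euclidean_all_zero_iff[of "w x"] by blast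
  qed
qed

section \<open>Calculus of weak partial derivatives\<close>

lemma test_function_partial:
  assumes "test_function \<phi>"
  obtains K M where "compact K" "\<phi> \<in> borel_measurable borel" "partial j \<phi> \<in> borel_measurable borel"
    "\<And>x. \<bar>\<phi> x\<bar> \<le> M * indicator K x" "\<And>x. \<bar>partial j \<phi> x\<bar> \<le> M * indicator K x"
proof -
  obtain K where K: "compact K" "\<And>x. x \<notin> K \<Longrightarrow> \<phi> x = 0" and sm: "\<And>n. Ck_on n UNIV \<phi>"
    using assms unfolding test_function_def smooth_on_def by blast
  have c0: "continuous_on UNIV \<phi>" using sm[of 0] by simp
  have "Ck_on 1 UNIV \<phi>" by (rule sm)
  then have c1: "continuous_on UNIV (partial j \<phi>)" by (simp add: partial_def[abs_def])
  \<comment> \<open>The complement of \<open>K\<close> is open and \<open>\<phi>\<close> vanishes on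
    it, so its derivative vanishes there too.\<close>
  have z: "partial j \<phi> x = 0" if "x \<notin> K" for x
  proof -
    have "((\<lambda>_. 0) has_derivative (\<lambda>_. 0)) (at x)" by simp
    then have "(\<phi> has_derivative (\<lambda>_. 0)) (at x)"
      by (rule has_derivative_transform_within_open[of _ _ _ UNIV "- K"])
         (use K that in \<open>auto simp: compact_imp_closed open_Compl\<close>)
    then show ?thesis unfolding partial_def by (metis frechet_derivative_at)
  qed
  have "compact (\<phi> ` K)" "compact (partial j \<phi> ` K)"
    using K(1) continuous_on_subset[OF c0 subset_UNIV] continuous_on_subset[OF c1 subset_UNIV]
    by (simp_all add: compact_continuous_image)
  then have "bounded (\<phi> ` K)" "bounded (partial j \<phi> ` K)" by (auto intro: compact_imp_bounded)
  then obtain M1 M2 where M: "\<And>x. x \<in> K \<Longrightarrow> \<bar>\<phi> x\<bar> \<le> M1" "\<And>x. x \<in> K \<Longrightarrow> \<bar>partial j \<phi> x\<bar> \<le> M2"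
    unfolding bounded_real by blast
  show ?thesis
  proof (rule that[of K "max M1 M2"])
    show "\<bar>\<phi> x\<bar> \<le> max M1 M2 * indicator K x" for x
      using M(1)[of x] K(2)[of x] by (cases "x \<in> K") auto
    show "\<bar>partial j \<phi> x\<bar> \<le> max M1 M2 * indicator K x" for x
      using M(2)[of x] z[of x] by (cases "x \<in> K") auto
  qed (use K c0 c1 in \<open>auto intro: borel_measurable_continuous_onI\<close>)
qed

lemma locally_integrable_bounded_mult:
  fixes u :: "real^2 \<Rightarrow> 'b::euclidean_space"
  assumes u: "locally_integrable u" and K: "compact K" and f: "f \<in> borel_measurable borel"
    and M: "\<And>x. \<bar>f x\<bar> \<le> M * indicator K x"
  shows "integrable lborel (\<lambda>x. f x *\<^sub>R u x)"
proof (rule Bochner_Integration.integrable_bound)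
  have "integrable lborel (\<lambda>x. indicator K x *\<^sub>R u x)"
    using u K unfolding locally_integrable_def set_integrable_def by blast
  then show "integrable lborel (\<lambda>x. M *\<^sub>R (indicator K x *\<^sub>R u x))"
    by (rule integrable_scaleR_right)
  show "(\<lambda>x. f x *\<^sub>R u x) \<in> borel_measurable lborel"
    using f locally_integrable_measurable[OF u] by simp
  have "norm (f x *\<^sub>R u x) \<le> norm (M *\<^sub>R (indicator K x *\<^sub>R u x))" for x
    using mult_right_mono[OF order.trans[OF M[of x] abs_ge_self], of "norm (u x)"] by (simp add: abs_mult)
  then show "AE x in lborel. norm (f x *\<^sub>R u x) \<le> norm (M *\<^sub>R (indicator K x *\<^sub>R u x))" by auto
qed

lemma locally_integrable_lincomb:
  fixes u :: "real^2 \<Rightarrow> 'b::euclidean_space"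
  assumes "locally_integrable u" "locally_integrable v"
  shows "locally_integrable (\<lambda>x. a *\<^sub>R u x + b *\<^sub>R v x)"
  unfolding locally_integrable_def
proof (intro allI impI set_integral_add)
  fix K :: "(real^2) set" assume "compact K"
  then show "set_integrable lborel K (\<lambda>x. a *\<^sub>R u x)" "set_integrable lborel K (\<lambda>x. b *\<^sub>R v x)"
    using assms unfolding locally_integrable_def by auto
qed

lemma locally_integrable_cong_AE:
  fixes u :: "real^2 \<Rightarrow> 'b::euclidean_space"
  assumes "locally_integrable u" "AE x in lborel. u' x = u x" "u' \<in> borel_measurable borel"
  shows "locally_integrable u'"
  unfolding locally_integrable_def set_integrable_def
proof (intro allI impI)
  fix K :: "(real^2) set" assume K: "compact K"
  then have [measurable]: "K \<in> sets borel" by (simp add: borel_compact)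
  have "integrable lborel (\<lambda>x. indicator K x *\<^sub>R u x)"
    using assms K unfolding locally_integrable_def set_integrable_def by blast
  then show "integrable lborel (\<lambda>x. indicator K x *\<^sub>R u' x)"
    by (rule integrable_cong_AE_imp) (use assms in \<open>auto elim: eventually_mono\<close>)
qed

text \<open>\<open>lborel\<close> is not complete: a function almost everywhere equal to a Borel
  function may fail to be Borel, hence the explicit measurability of \<open>u'\<close> and
  \<open>w'\<close>.\<close>

lemma weak_partial_cong_AE:
  fixes u :: "real^2 \<Rightarrow> 'b::euclidean_space"
  assumes w: "weak_partial j u w"
    and u': "AE x in lborel. u' x = u x" "u' \<in> borel_measurable borel"
    and w': "AE x in lborel. w' x = w x" "w' \<in> borel_measurable borel"
  shows "weak_partial j u' w'"
  unfolding weak_partial_def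
proof (intro conjI allI impI)
  have li: "locally_integrable u" "locally_integrable w" using w by (auto simp: weak_partial_def)
  then show "locally_integrable u'" "locally_integrable w'"
    using locally_integrable_cong_AE u' w' by blast+
  note [measurable] = li[THEN locally_integrable_measurable] u'(2) w'(2)
  fix \<phi> assume \<phi>: "test_function \<phi>"
  obtain K M where [measurable]: "\<phi> \<in> borel_measurable borel" "partial j \<phi> \<in> borel_measurable borel"
    using test_function_partial[OF \<phi>, of j] by metis
  have "(LINT x|lborel. partial j \<phi> x *\<^sub>R u' x) = (LINT x|lborel. partial j \<phi> x *\<^sub>R u x)"
    by (rule integral_cong_AE) (use u' in \<open>auto elim: eventually_mono\<close>)
  moreover have "(LINT x|lborel. \<phi> x *\<^sub>R w' x) = (LINT x|lborel. \<phi> x *\<^sub>R w x)"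
    by (rule integral_cong_AE) (use w' in \<open>auto elim: eventually_mono\<close>)
  ultimately show "(LINT x|lborel. partial j \<phi> x *\<^sub>R u' x) = - (LINT x|lborel. \<phi> x *\<^sub>R w' x)"
    using w \<phi> by (simp add: weak_partial_def)
qed

lemma weak_partial_lincomb:
  fixes u :: "real^2 \<Rightarrow> 'b::euclidean_space"
  assumes u: "weak_partial j u1 w1" "weak_partial j u w2"
  shows "weak_partial j (\<lambda>x. a *\<^sub>R u1 x + b *\<^sub>R u x) (\<lambda>x. a *\<^sub>R w1 x + b *\<^sub>R w2 x)"
  unfolding weak_partial_def
proof (intro conjI allI impI)
  have li: "locally_integrable u1" "locally_integrable w1" "locally_integrable u" "locally_integrable w2"
    using u by (auto simp: weak_partial_def)
  then show "locally_integrable (\<lambda>x. a *\<^sub>R u1 x + b *\<^sub>R u x)" "locally_integrable (\<lambda>x. a *\<^sub>R w1 x + b *\<^sub>R w2 x)"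
    using locally_integrable_lincomb by blast+
  fix \<phi> assume \<phi>: "test_function \<phi>"
  obtain K M where K: "compact K" "\<phi> \<in> borel_measurable borel" "partial j \<phi> \<in> borel_measurable borel"
    "\<And>x. \<bar>\<phi> x\<bar> \<le> M * indicator K x" "\<And>x. \<bar>partial j \<phi> x\<bar> \<le> M * indicator K x"
    using test_function_partial[OF \<phi>, of j] by metis
  note i1 = locally_integrable_bounded_mult[OF _ K(1,2,4)]
    and i2 = locally_integrable_bounded_mult[OF _ K(1,3,5)]
  have "(LINT x|lborel. partial j \<phi> x *\<^sub>R (a *\<^sub>R u1 x + b *\<^sub>R u x)) =
     (LINT x|lborel. a *\<^sub>R (partial j \<phi> x *\<^sub>R u1 x) + b *\<^sub>R (partial j \<phi> x *\<^sub>R u x))"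
    by (simp add: scaleR_add_right mult.commute)
  also have "\<dots> = a *\<^sub>R (LINT x|lborel. partial j \<phi> x *\<^sub>R u1 x) + b *\<^sub>R (LINT x|lborel. partial j \<phi> x *\<^sub>R u x)"
    using i2[OF li(1)] i2[OF li(3)] by (simp del: scaleR_scaleR)
  also have "\<dots> = - (a *\<^sub>R (LINT x|lborel. \<phi> x *\<^sub>R w1 x) + b *\<^sub>R (LINT x|lborel. \<phi> x *\<^sub>R w2 x))"
    using u \<phi> by (simp add: weak_partial_def)
  also have "a *\<^sub>R (LINT x|lborel. \<phi> x *\<^sub>R w1 x) + b *\<^sub>R (LINT x|lborel. \<phi> x *\<^sub>R w2 x) =
    (LINT x|lborel. a *\<^sub>R (\<phi> x *\<^sub>R w1 x) + b *\<^sub>R (\<phi> x *\<^sub>R w2 x))"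
    using i1[OF li(2)] i1[OF li(4)] by (simp del: scaleR_scaleR)
  also have "\<dots> = (LINT x|lborel. \<phi> x *\<^sub>R (a *\<^sub>R w1 x + b *\<^sub>R w2 x))"
    by (simp add: scaleR_add_right mult.commute)
  finally show "(LINT x|lborel. partial j \<phi> x *\<^sub>R (a *\<^sub>R u1 x + b *\<^sub>R u x)) =
     - (LINT x|lborel. \<phi> x *\<^sub>R (a *\<^sub>R w1 x + b *\<^sub>R w2 x))" .
qed

text \<open>By linearity \<open>w1 - w2\<close> is a weak derivative of zero, so it integrates to
  zero against every test function.\<close>

lemma weak_partial_unique:
  fixes u :: "real^2 \<Rightarrow> 'b::euclidean_space"
  assumes "weak_partial j u w1" "weak_partial j u w2"
  shows "AE x in lborel. w1 x = w2 x"
proof -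
  have "weak_partial j (\<lambda>x. 1 *\<^sub>R u x + (-1) *\<^sub>R u x) (\<lambda>x. 1 *\<^sub>R w1 x + (-1) *\<^sub>R w2 x)"
    by (rule weak_partial_lincomb[OF assms])
  then have "AE x in lborel. 1 *\<^sub>R w1 x + (-1) *\<^sub>R w2 x = 0"
    by (intro test_function_integral_zero_imp_AE_zero) (auto simp: weak_partial_def)
  then show ?thesis by eventually_elim simp
qed

section \<open>Stereographic charts\<close>

lemma vector_3_eq: "(vector [a, b, c] :: real^3) = a *\<^sub>R axis 1 1 + b *\<^sub>R axis 2 1 + c *\<^sub>R axis 3 1"
  by (simp add: vec_eq_iff forall_3 axis_def vector_3)

lemma norm_vec2: "(norm (u :: real^2))\<^sup>2 = (u$1)\<^sup>2 + (u$2)\<^sup>2"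
  by (simp add: norm_vec_def L2_set_def sum_2)

lemma stereo_has_derivative:
  "(stereo s has_derivative (\<lambda>v. (1 / ((norm u)\<^sup>2 + 1)) *\<^sub>R vector [2 * v$1, 2 * v$2, pole_sign s * (2 * (u \<bullet> v))]
      - (2 * (u \<bullet> v) / ((norm u)\<^sup>2 + 1)\<^sup>2) *\<^sub>R vector [2 * u$1, 2 * u$2, pole_sign s * ((norm u)\<^sup>2 - 1)])) (at u)"
proof -
  have "u \<bullet> u + 1 > 0" by (simp add: add_nonneg_pos)
  then have [simp]: "u \<bullet> u + 1 \<noteq> 0" by linarith
  show ?thesis
    unfolding stereo_def[abs_def] vector_3_eq power2_norm_eq_inner
    by (rule has_derivative_eq_rhs, (rule derivative_eq_intros bounded_linear.has_derivative[OF bounded_linear_vec_nth] refl | simp)+)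
       (auto simp: fun_eq_iff inner_commute power2_eq_square divide_simps vec_eq_iff axis_def)
qed

lemma partial_stereo:
  "partial j (stereo s) u = (1 / ((norm u)\<^sup>2 + 1)) *\<^sub>R vector [2 * axis j 1$1, 2 * axis j 1$2, pole_sign s * (2 * (u $ j))]
      - (2 * (u $ j) / ((norm u)\<^sup>2 + 1)\<^sup>2) *\<^sub>R vector [2 * u$1, 2 * u$2, pole_sign s * ((norm u)\<^sup>2 - 1)]"
  unfolding partial_def frechet_derivative_at[OF stereo_has_derivative, symmetric]
  by (simp add: inner_axis)

lemma pole_sign_square: "pole_sign s * pole_sign s = 1"
  by (cases s) auto

lemma axis_component_2: "(axis 1 1 :: real^2)$1 = 1" "(axis 1 1 :: real^2)$2 = 0"
  "(axis 2 1 :: real^2)$1 = 0" "(axis 2 1 :: real^2)$2 = 1"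
  by (simp_all add: axis_def)

lemma stereo_components:
  fixes u :: "real^2"
  defines "r \<equiv> (u$1)\<^sup>2 + (u$2)\<^sup>2 + 1"
  shows "stereo s u $ 1 = 2 * u$1 / r" "stereo s u $ 2 = 2 * u$2 / r" "stereo s u $ 3 = pole_sign s * (r - 2) / r"
    "partial 1 (stereo s) u $ 1 = 2 / r - 4 * (u$1)\<^sup>2 / r\<^sup>2"
    "partial 1 (stereo s) u $ 2 = - 4 * u$1 * u$2 / r\<^sup>2"
    "partial 1 (stereo s) u $ 3 = pole_sign s * 4 * u$1 / r\<^sup>2"
    "partial 2 (stereo s) u $ 1 = - 4 * u$1 * u$2 / r\<^sup>2"
    "partial 2 (stereo s) u $ 2 = 2 / r - 4 * (u$2)\<^sup>2 / r\<^sup>2"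
    "partial 2 (stereo s) u $ 3 = pole_sign s * 4 * u$2 / r\<^sup>2"
proof -
  have r: "r > 0" unfolding r_def by (simp add: add_nonneg_pos)
  have r': "(norm u)\<^sup>2 + 1 = r" "(norm u)\<^sup>2 - 1 = r - 2" by (simp_all add: r_def norm_vec2)
  show "stereo s u $ 1 = 2 * u$1 / r" "stereo s u $ 2 = 2 * u$2 / r" "stereo s u $ 3 = pole_sign s * (r - 2) / r"
    by (simp_all add: stereo_def r' vector_3)
  show "partial 1 (stereo s) u $ 1 = 2 / r - 4 * (u$1)\<^sup>2 / r\<^sup>2"
    "partial 1 (stereo s) u $ 2 = - 4 * u$1 * u$2 / r\<^sup>2"
    "partial 1 (stereo s) u $ 3 = pole_sign s * 4 * u$1 / r\<^sup>2"
    "partial 2 (stereo s) u $ 1 = - 4 * u$1 * u$2 / r\<^sup>2"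
    "partial 2 (stereo s) u $ 2 = 2 / r - 4 * (u$2)\<^sup>2 / r\<^sup>2"
    "partial 2 (stereo s) u $ 3 = pole_sign s * 4 * u$2 / r\<^sup>2"
    unfolding partial_stereo r' using r
    by (simp_all add: vector_3 axis_component_2 divide_simps power2_eq_square)
       (simp_all add: algebra_simps)
qed

lemma inner_vec3: "(x :: real^3) \<bullet> y = x$1 * y$1 + x$2 * y$2 + x$3 * y$3"
  by (simp add: inner_vec_def sum_3)

text \<open>Stereographic projection is conformal: the coordinate vectors are orthogonal of common
  length \<open>2 / r\<close>. After clearing denominators these are polynomial identities modulo
  \<open>c * c = 1\<close> for the sign \<open>c\<close> of the pole.\<close>

lemma stereo_inner:
  fixes u :: "real^2"
  defines "r \<equiv> (u$1)\<^sup>2 + (u$2)\<^sup>2 + 1"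
  shows "stereo s u \<bullet> stereo s u = 1" "stereo s u \<bullet> partial j (stereo s) u = 0"
    "partial i (stereo s) u \<bullet> partial j (stereo s) u = (if i = j then 4 / r\<^sup>2 else 0)"
proof -
  have r: "r > 0" unfolding r_def by (simp add: add_nonneg_pos)
  define a b c where "a = u$1" and "b = u$2" and "c = pole_sign s"
  have c: "c * c = 1" unfolding c_def by (rule pole_sign_square)
  have r': "r = a * a + b * b + 1" by (simp add: r_def a_def b_def power2_eq_square)
  note comp = stereo_components[of s u, folded r_def, folded a_def b_def c_def]
  show "stereo s u \<bullet> stereo s u = 1"
    unfolding inner_vec3 comp using r c
    by (simp add: divide_simps power2_eq_square) (use r' in algebra)
  have 12: "j = 1 \<or> j = 2" for j :: 2 using exhaust_2 by blast
  have "stereo s u \<bullet> partial 1 (stereo s) u = 0" "stereo s u \<bullet> partial 2 (stereo s) u = 0"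
    unfolding inner_vec3 comp using r
    by (simp_all add: divide_simps power2_eq_square) (use r' c in algebra)+
  then show "stereo s u \<bullet> partial j (stereo s) u = 0" using 12[of j] by auto
  have 1: "partial 1 (stereo s) u \<bullet> partial 2 (stereo s) u = 0"
    unfolding inner_vec3 comp using r
    by (simp add: divide_simps power2_eq_square) (use r' c in algebra)
  have 2: "partial 1 (stereo s) u \<bullet> partial 1 (stereo s) u = 4 / r\<^sup>2" "partial 2 (stereo s) u \<bullet> partial 2 (stereo s) u = 4 / r\<^sup>2"
    unfolding inner_vec3 comp using r
    by (simp_all add: divide_simps power2_eq_square) (use r' c in algebra)+
  show "partial i (stereo s) u \<bullet> partial j (stereo s) u = (if i = j then 4 / r\<^sup>2 else 0)"
    using 12[of i] 12[of j] 1 2 by (auto simp: inner_commute)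
qed

lemma stereo_in_S2: "stereo s u \<in> S2"
  using stereo_inner(1)[of s u] by (simp add: norm_eq_1)

lemma partial_stereo_tangent: "partial j (stereo s) u \<in> tangent (stereo s u)"
  using stereo_inner(2) by (simp add: tangent_def)

lemma tangent_closed:
  "v \<in> tangent x \<Longrightarrow> w \<in> tangent x \<Longrightarrow> v + w \<in> tangent x" "v \<in> tangent x \<Longrightarrow> c *\<^sub>R v \<in> tangent x"
  by (simp_all add: tangent_def inner_add_right)

text \<open>The position vector and the two coordinate vectors form an orthogonal basis of the
  ambient space, and a tangent vector has no component along the first.\<close>

lemma tangent_stereo_expansion:
  assumes "v \<in> tangent (stereo s u)"
  shows "\<exists>c. v = (\<Sum>j\<in>UNIV. c j *\<^sub>R partial j (stereo s) u)"
proof -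
  define r where "r = (u$1)\<^sup>2 + (u$2)\<^sup>2 + 1"
  have r: "r > 0" unfolding r_def by (simp add: add_nonneg_pos)
  let ?x = "stereo s u" and ?P = "\<lambda>j. partial j (stereo s) u"
  note ip = stereo_inner[where s = s and u = u, folded r_def]
  have ip': "?P i \<bullet> ?x = 0" for i using ip(2)[of i] by (simp add: inner_commute)
  have nz: "?x \<noteq> 0" "?P j \<noteq> 0" for j using ip(1) ip(3)[of j j] r by auto
  have ne: "y \<noteq> z" if "y \<bullet> z = 0" "y \<noteq> 0" for y z :: "real^3" using that by auto
  have "?P 1 \<bullet> ?P 2 = 0" using ip(3)[of 1 2] by simp
  then have "?x \<noteq> ?P 1" "?x \<noteq> ?P 2" "?P 1 \<noteq> ?P 2"
    using ne ip(2) nz by blast+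
  then have card: "card {?x, ?P 1, ?P 2} = 3" by simp
  have "pairwise orthogonal {?x, ?P 1, ?P 2}"
    using ip ip' by (auto simp: pairwise_def orthogonal_def)
  then have "independent {?x, ?P 1, ?P 2}"
    using nz by (intro pairwise_orthogonal_independent) auto
  then have "UNIV \<subseteq> span {?x, ?P 1, ?P 2}"
    using card by (intro iffD1[OF card_eq_dim]) auto
  then have span: "span {?x, ?P 1, ?P 2} = UNIV" by blast
  \<comment> \<open>\<open>r\<^sup>2 / 4\<close> is the reciprocal of the squared length of a
    coordinate vector, so \<open>z\<close> is \<open>v\<close> minus its orthogonal projection onto
    the coordinate plane.\<close>
  define z where "z = v - (\<Sum>j\<in>UNIV. (r\<^sup>2 / 4 * (v \<bullet> ?P j)) *\<^sub>R ?P j)"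
  have "z \<bullet> ?P 1 = 0" "z \<bullet> ?P 2 = 0" "z \<bullet> ?x = 0"
    unfolding z_def sum_2 inner_diff_left inner_add_left inner_scaleR_left ip ip'
    using r assms by (auto simp: tangent_def inner_commute)
  then have "orthogonal z y" if "y \<in> {?x, ?P 1, ?P 2}" for y using that by (auto simp: orthogonal_def)
  then have "orthogonal z z" using span by (intro orthogonal_to_span[of z "{?x, ?P 1, ?P 2}"]) auto
  then have "z = 0" by (simp add: orthogonal_def)
  then show ?thesis unfolding z_def by auto
qed

text \<open>Projection from the north pole. At the pole itself division by zero returns the origin,
  so that point is always excluded or treated separately.\<close>

definition stereo_inv :: "real^3 \<Rightarrow> real^2" where
  "stereo_inv x = vector [x$1 / (1 - x$3), x$2 / (1 - x$3)]"

definition north_pole :: "real^3" where "north_pole = axis 3 1"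

lemma stereo_inv_stereo: "stereo_inv (stereo North u) = u"
proof -
  define r where "r = (u$1)\<^sup>2 + (u$2)\<^sup>2 + 1"
  have r: "r > 0" unfolding r_def by (simp add: add_nonneg_pos)
  show ?thesis
    using r unfolding stereo_inv_def stereo_components(1-3)[of North u, folded r_def]
    by (simp add: vec_eq_iff forall_2 vector_2 divide_simps)
qed

lemma stereo_neq_north_pole: "stereo North u \<noteq> north_pole"
proof -
  define r where "r = (u$1)\<^sup>2 + (u$2)\<^sup>2 + 1"
  have r: "r > 0" unfolding r_def by (simp add: add_nonneg_pos)
  have "stereo North u $ 3 \<noteq> 1"
    unfolding stereo_components(3)[of North u, folded r_def] using r by (simp add: divide_simps)
  then show ?thesis by (auto simp: north_pole_def axis_def)
qed

lemma stereo_stereo_inv: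
  assumes "x \<in> S2" "x \<noteq> north_pole"
  shows "stereo North (stereo_inv x) = x"
proof -
  have n: "(x$1)\<^sup>2 + (x$2)\<^sup>2 + (x$3)\<^sup>2 = 1"
    using assms(1) by (simp add: norm_eq_1 inner_vec3 power2_eq_square)
  have 3: "x$3 \<noteq> 1"
  proof
    assume "x$3 = 1"
    then have "(x$1)\<^sup>2 + (x$2)\<^sup>2 = 0" using n by simp
    then have "x$1 = 0" "x$2 = 0" by (auto simp: sum_power2_eq_zero_iff)
    then show False using assms(2) \<open>x$3 = 1\<close> by (simp add: north_pole_def vec_eq_iff forall_3 axis_def)
  qed
  have u: "stereo_inv x $ 1 = x$1 / (1 - x$3)" "stereo_inv x $ 2 = x$2 / (1 - x$3)"
    by (simp_all add: stereo_inv_def vector_2)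
  define d where "d = 1 - x$3"
  have d: "d \<noteq> 0" "x$3 = 1 - d" using 3 by (auto simp: d_def)
  have "(x$1)\<^sup>2 + (x$2)\<^sup>2 = d * (2 - d)" using n by (simp add: d_def algebra_simps power2_eq_square)
  then have r: "(stereo_inv x $ 1)\<^sup>2 + (stereo_inv x $ 2)\<^sup>2 + 1 = 2 / d"
    unfolding u d_def[symmetric] power_divide add_divide_distrib[symmetric]
    using d(1) by (simp add: field_simps power2_eq_square)
  show ?thesis
    unfolding vec_eq_iff forall_3 stereo_components r unfolding u unfolding d_def[symmetric] using d by (simp add: divide_simps)
qed

text \<open>The transition map between the charts is inversion in the unit circle.\<close>

lemma stereo_South_eq:
  assumes "u \<noteq> 0"
  shows "stereo South u = stereo North ((1 / (u \<bullet> u)) *\<^sub>R u)"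
proof -
  define q where "q = u \<bullet> u"
  have q: "q > 0" using assms by (simp add: q_def)
  have 1: "(u$1)\<^sup>2 + (u$2)\<^sup>2 = q" by (simp add: q_def flip: power2_norm_eq_inner norm_vec2)
  have 2: "(((1 / q) *\<^sub>R u) $ 1)\<^sup>2 + (((1 / q) *\<^sub>R u) $ 2)\<^sup>2 = 1 / q"
    using 1 q by (simp add: power_mult_distrib power_divide flip: add_divide_distrib) (simp add: power2_eq_square)
  show ?thesis
    unfolding vec_eq_iff forall_3 stereo_components q_def[symmetric] 1 2 using q
    by (simp add: divide_simps)
qed

lemma continuous_stereo: "continuous_on UNIV (stereo s)"
  by (rule has_derivative_continuous_on[OF has_derivative_at_withinI[OF stereo_has_derivative]])

lemma stereo_measurable [measurable]: "stereo s \<in> borel \<rightarrow>\<^sub>M restrict_space borel S2"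
  by (rule measurable_restrict_space2)
     (use stereo_in_S2 continuous_stereo in \<open>auto intro: borel_measurable_continuous_onI\<close>)

lemma stereo_inv_measurable [measurable]: "stereo_inv \<in> borel_measurable borel"
proof -
  have *: "stereo_inv = (\<lambda>x. (x$1 / (1 - x$3)) *\<^sub>R axis 1 1 + (x$2 / (1 - x$3)) *\<^sub>R axis 2 1)"
    by (auto simp: fun_eq_iff stereo_inv_def vec_eq_iff forall_2 axis_def vector_2)
  have [measurable]: "(\<lambda>x :: real^3. x $ i) \<in> borel_measurable borel" for i
    by (intro borel_measurable_continuous_onI continuous_intros)
  show ?thesis unfolding * by measurable
qed

text \<open>The exceptional set in one chart is, up to the origin, the image of that in the other
  under inversion, and differentiable maps between spaces of equal dimension preserve negligible
  sets. As \<open>P\<close> is arbitrary, the set need not be Borel, which is why the completion of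
  \<open>lborel\<close> appears.\<close>

lemma AE_stereo_North_imp_South:
  assumes "AE u in lborel. P (stereo North u)"
  shows "AE u in lborel. P (stereo South u)"
proof -
  define N where "N = {u. \<not> P (stereo North u)}"
  define f where "f u = (1 / (u \<bullet> u)) *\<^sub>R u" for u :: "real^2"
  have "negligible N"
    using assms unfolding AE_completion_iff[where M = lborel, symmetric] eventually_ae_filter_negligible N_def
    by (blast intro: negligible_subset)
  have "f differentiable_on (N - {0})"
    unfolding f_def differentiable_on_def by (auto intro!: derivative_intros differentiable_at_withinI)
  then have "negligible (f ` (N - {0}))"
    using \<open>negligible N\<close> negligible_subset by (intro negligible_differentiable_image_negligible) blast+
  then have "negligible (insert 0 (f ` (N - {0})))" by simp
  moreover have "{u. \<not> P (stereo South u)} \<subseteq> insert 0 (f ` (N - {0}))"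
  proof
    fix u assume u: "u \<in> {u. \<not> P (stereo South u)}"
    have "u = f (f u)" "f u \<noteq> 0" if "u \<noteq> 0" using that by (auto simp: f_def power2_eq_square)
    then show "u \<in> insert 0 (f ` (N - {0}))"
      using u stereo_South_eq[of u] unfolding N_def f_def[symmetric] by (cases "u = 0") auto
  qed
  ultimately show ?thesis
    unfolding AE_completion_iff[where M = lborel, symmetric] eventually_ae_filter_negligible by blast
qed

section \<open>The inner product of tensors\<close>

lemma matrix_inv_eqI:
  fixes A B :: "real^'n^'n"
  assumes "A ** B = mat 1"
  shows "matrix_inv A = B"
proof -
  have BA: "B ** A = mat 1" using assms matrix_left_right_inverse by blast
  have "A ** matrix_inv A = mat 1 \<and> matrix_inv A ** A = mat 1"
    unfolding matrix_inv_def by (rule someI[of _ B]) (use assms BA in simp)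
  then have "B ** (A ** matrix_inv A) = B" by simp
  then show ?thesis by (simp add: matrix_mul_assoc BA)
qed

text \<open>\<open>matrix_inv\<close> is a Hilbert choice; Cramer's formula makes its measurable
  dependence on the entries visible.\<close>

lemma matrix_inv_2:
  fixes A :: "real^2^2"
  assumes "det A \<noteq> 0"
  shows "matrix_inv A $ a $ b = (if a = b then (if a = 1 then A$2$2 else A$1$1) else - A$a$b) / det A"
proof -
  define B :: "real^2^2" where
    "B = (\<chi> a b. (if a = b then (if a = 1 then A$2$2 else A$1$1) else - A$a$b) / det A)"
  have "A ** B = mat 1"
    unfolding vec_eq_iff forall_2 matrix_matrix_mult_def mat_def B_def using assms
    by (simp add: sum_2 divide_simps) (simp add: det_2 algebra_simps)
  then show ?thesis using matrix_inv_eqI[of A B] by (simp add: B_def)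
qed

lemma gram_nth: "gram g s u $ i $ j = g (stereo s u) (partial i (stereo s) u) (partial j (stereo s) u)"
  by (simp add: gram_def)

lemma riemannian_metricD:
  assumes "riemannian_metric g" "x \<in> S2"
  shows "bilinear (g x)" "v \<in> tangent x \<Longrightarrow> w \<in> tangent x \<Longrightarrow> g x v w = g x w v"
    "v \<in> tangent x \<Longrightarrow> v \<noteq> 0 \<Longrightarrow> g x v v > 0"
  using assms unfolding riemannian_metric_def by blast+

lemma gram_quadratic:
  assumes "riemannian_metric g"
  shows "g (stereo s u) (a *\<^sub>R partial 1 (stereo s) u + b *\<^sub>R partial 2 (stereo s) u)
       (c *\<^sub>R partial 1 (stereo s) u + d *\<^sub>R partial 2 (stereo s) u) =
     a * c * gram g s u $ 1 $ 1 + (a * d + b * c) * gram g s u $ 1 $ 2 + b * d * gram g s u $ 2 $ 2"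
proof -
  note bl = riemannian_metricD(1)[OF assms stereo_in_S2[of s u]]
  have "gram g s u $ 2 $ 1 = gram g s u $ 1 $ 2"
    unfolding gram_nth by (intro riemannian_metricD(2)[OF assms stereo_in_S2] partial_stereo_tangent)
  then show ?thesis
    by (simp add: bilinear_ladd[OF bl] bilinear_radd[OF bl] bilinear_lmul[OF bl] bilinear_rmul[OF bl]
        gram_nth algebra_simps)
qed

lemma partial_stereo_independent:
  assumes "a *\<^sub>R partial 1 (stereo s) u + b *\<^sub>R partial 2 (stereo s) u = 0"
  shows "a = 0" "b = 0"
proof -
  define r where "r = (u$1)\<^sup>2 + (u$2)\<^sup>2 + 1"
  have r: "r > 0" unfolding r_def by (simp add: add_nonneg_pos)
  let ?v = "a *\<^sub>R partial 1 (stereo s) u + b *\<^sub>R partial 2 (stereo s) u"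
  have "?v \<bullet> partial 1 (stereo s) u = 0" "?v \<bullet> partial 2 (stereo s) u = 0"
    unfolding assms by simp_all
  then show "a = 0" "b = 0"
    using r unfolding inner_add_left inner_scaleR_left stereo_inner(3)[where u = u, folded r_def] by auto
qed

lemma gram_positive:
  assumes "riemannian_metric g"
  shows "gram g s u $ 1 $ 1 > 0" "det (gram g s u) > 0" "gram g s u $ 2 $ 1 = gram g s u $ 1 $ 2"
proof -
  let ?P = "\<lambda>j. partial j (stereo s) u" and ?G = "gram g s u"
  show sym: "?G $ 2 $ 1 = ?G $ 1 $ 2"
    unfolding gram_nth by (intro riemannian_metricD(2)[OF assms stereo_in_S2] partial_stereo_tangent)
  have pos: "g (stereo s u) (a *\<^sub>R ?P 1 + b *\<^sub>R ?P 2) (a *\<^sub>R ?P 1 + b *\<^sub>R ?P 2) > 0" if "a \<noteq> 0 \<or> b \<noteq> 0" for a b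
    using partial_stereo_independent[of a s u b] that
    by (intro riemannian_metricD(3)[OF assms stereo_in_S2] tangent_closed partial_stereo_tangent) blast
  show 1: "?G $ 1 $ 1 > 0" using pos[of 1 0] unfolding gram_quadratic[OF assms] by simp
  \<comment> \<open>This product is the squared length of the nonzero vector
    \<open>- G12 * P 1 + G11 * P 2\<close>.\<close>
  have "?G $ 1 $ 1 * det ?G > 0"
    using pos[of "- ?G $ 1 $ 2" "?G $ 1 $ 1"] 1 unfolding gram_quadratic[OF assms]
    by (simp add: det_2 sym algebra_simps)
  then show "det ?G > 0" using 1 by (simp add: zero_less_mult_iff)
qed

text \<open>Gram-Schmidt applied to the coordinate vectors, with \<open>n1\<close> and
  \<open>n2\<close> the normalizing factors. It ensures that the frame chosen by \<open>SOME\<close>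
  in \<open>tensor_norm\<close> is orthonormal.\<close>

lemma orthonormal_frame_exists:
  assumes "riemannian_metric g"
  shows "\<exists>e. orthonormal_frame g (stereo s u) e"
proof -
  let ?P = "\<lambda>j. partial j (stereo s) u" and ?G = "gram g s u"
  note pos = gram_positive[OF assms, of s u]
  define n1 where "n1 = 1 / sqrt (?G $ 1 $ 1)"
  define n2 where "n2 = 1 / sqrt (?G $ 1 $ 1 * det ?G)"
  have n: "n1 * n1 * ?G $ 1 $ 1 = 1" "n2 * n2 * (?G $ 1 $ 1 * det ?G) = 1"
    using pos by (simp_all add: n1_def n2_def)
  define e where "e j = (if j = 1 then n1 *\<^sub>R ?P 1 + 0 *\<^sub>R ?P 2
      else (- n2 * ?G $ 1 $ 2) *\<^sub>R ?P 1 + (n2 * ?G $ 1 $ 1) *\<^sub>R ?P 2)" for j :: 2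
  have "orthonormal_frame g (stereo s u) e"
    unfolding orthonormal_frame_def forall_2
  proof (intro conjI)
    show "e 1 \<in> tangent (stereo s u)" "e 2 \<in> tangent (stereo s u)"
      unfolding e_def by (split if_split, intro conjI impI tangent_closed partial_stereo_tangent)+
    show "g (stereo s u) (e 1) (e 1) = (if (1::2) = 1 then 1 else 0)"
      unfolding e_def using gram_quadratic[OF assms, of s u n1 0 n1 0] n by simp
    show "g (stereo s u) (e 1) (e 2) = (if (1::2) = 2 then 1 else 0)"
      unfolding e_def using gram_quadratic[OF assms, of s u n1 0 "- n2 * ?G $ 1 $ 2" "n2 * ?G $ 1 $ 1"] by simp
    show "g (stereo s u) (e 2) (e 1) = (if (2::2) = 1 then 1 else 0)"
      unfolding e_def using gram_quadratic[OF assms, of s u "- n2 * ?G $ 1 $ 2" "n2 * ?G $ 1 $ 1" n1 0] by simp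
    show "g (stereo s u) (e 2) (e 2) = (if (2::2) = 2 then 1 else 0)"
      unfolding e_def using n(2)
        gram_quadratic[OF assms, of s u "- n2 * ?G $ 1 $ 2" "n2 * ?G $ 1 $ 1" "- n2 * ?G $ 1 $ 2" "n2 * ?G $ 1 $ 1"]
      by (simp add: det_2 pos(3) algebra_simps)
  qed
  then show ?thesis by blast
qed

text \<open>If \<open>M\<close> holds the coordinates of the frame, orthonormality reads
  \<open>M G M^T = 1\<close>. Hence \<open>M^T M\<close> is the inverse of \<open>G\<close>,
  whichever frame was chosen.\<close>

lemma orthonormal_frame_expansion:
  assumes g: "riemannian_metric g" and e: "orthonormal_frame g (stereo s u) e"
  shows "\<exists>C. (\<forall>i. e i = (\<Sum>j\<in>UNIV. C i j *\<^sub>R partial j (stereo s) u)) \<and>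
    (\<forall>a b. (\<Sum>j\<in>UNIV. C j a * C j b) = matrix_inv (gram g s u) $ a $ b)"
proof -
  let ?P = "\<lambda>j. partial j (stereo s) u" and ?G = "gram g s u"
  have "\<forall>i. \<exists>c. e i = (\<Sum>j\<in>UNIV. c j *\<^sub>R ?P j)"
    using e tangent_stereo_expansion unfolding orthonormal_frame_def by blast
  then obtain C where C: "\<And>i. e i = (\<Sum>j\<in>UNIV. C i j *\<^sub>R ?P j)" by metis
  define M :: "real^2^2" where "M = (\<chi> i j. C i j)"
  have sym: "?G $ 2 $ 1 = ?G $ 1 $ 2" by (rule gram_positive[OF g])
  have "(if i = j then 1 else 0) = C i 1 * C j 1 * ?G $ 1 $ 1 + (C i 1 * C j 2 + C i 2 * C j 1) * ?G $ 1 $ 2 + C i 2 * C j 2 * ?G $ 2 $ 2" for i j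
    using e gram_quadratic[OF g, of s u "C i 1" "C i 2" "C j 1" "C j 2"]
    unfolding orthonormal_frame_def C sum_2 by simp
  then have "M ** (?G ** transpose M) = mat 1"
    unfolding vec_eq_iff matrix_matrix_mult_def mat_def M_def transpose_def
    by (simp add: sum_2 sym algebra_simps)
  then have "(?G ** transpose M) ** M = mat 1"
    using matrix_left_right_inverse by blast
  then have "matrix_inv ?G = transpose M ** M"
    by (intro matrix_inv_eqI) (simp add: matrix_mul_assoc)
  then have "(\<Sum>j\<in>UNIV. C j a * C j b) = matrix_inv ?G $ a $ b" for a b
    by (simp add: matrix_matrix_mult_def transpose_def M_def)
  then show ?thesis using C by blast
qed

lemma finite_lists_length: "finite {J :: 'a::finite list. length J = i}"
  using finite_lists_length_eq[of "UNIV :: 'a set" i] by simp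

lemma sum_lists_length_Suc:
  fixes f :: "'a::finite list \<Rightarrow> 'b::comm_monoid_add"
  shows "(\<Sum>J | length J = Suc i. f J) = (\<Sum>j\<in>UNIV. \<Sum>J | length J = i. f (j # J))"
proof -
  have "{J :: 'a list. length J = Suc i} = (\<lambda>(j, J). j # J) ` (UNIV \<times> {J. length J = i})"
    by (auto simp: length_Suc_conv image_iff)
  moreover have "inj_on (\<lambda>(j, J). j # J) (UNIV \<times> {J :: 'a list. length J = i})"
    by (auto simp: inj_on_def)
  ultimately show ?thesis
    by (simp add: sum.reindex sum.cartesian_product case_prod_unfold)
qed

lemma multilinear_on_Cons:
  assumes "multilinear_on add scl V (Suc i) T" "v \<in> V"
  shows "multilinear_on add scl V i (\<lambda>vs. T (v # vs))"
  unfolding multilinear_on_def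
proof (intro allI impI conjI ballI)
  fix xs ys v' assume *: "length xs + 1 + length ys = i" "set xs \<subseteq> V" "set ys \<subseteq> V" "v' \<in> V"
  show "T (v # xs @ add v' w # ys) = T (v # xs @ v' # ys) + T (v # xs @ w # ys)" if "w \<in> V" for w
    using multilinear_on_add[OF assms(1), of "v # xs" ys v' w] * assms(2) that by simp
  show "T (v # xs @ scl c v' # ys) = c *\<^sub>R T (v # xs @ v' # ys)" for c
    using multilinear_on_scale[OF assms(1), of "v # xs" ys v' c] * assms(2) by simp
qed

text \<open>Induction on the rank: expanding the first slot in the basis \<open>P\<close> contracts
  two copies of \<open>C\<close> into one factor \<open>Q\<close>, and the remaining slots follow by
  the induction hypothesis.\<close>

lemma sum_frame_change:
  fixes T T' :: "(real^3) list \<Rightarrow> 'w::euclidean_space" and P e :: "2 \<Rightarrow> real^3"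
  assumes e: "\<And>i. e i = (\<Sum>j\<in>UNIV. C i j *\<^sub>R P j)" and Q: "\<And>a b. (\<Sum>j\<in>UNIV. C j a * C j b) = Q a b"
    and V: "\<And>j. P j \<in> V" "\<And>v w. v \<in> V \<Longrightarrow> w \<in> V \<Longrightarrow> v + w \<in> V" "\<And>c v. v \<in> V \<Longrightarrow> c *\<^sub>R v \<in> V"
    and T: "multilinear_on (+) (*\<^sub>R) V i T" "multilinear_on (+) (*\<^sub>R) V i T'"
  shows "(\<Sum>J | length J = i. T (map e J) \<bullet> T' (map e J)) =
    (\<Sum>K | length K = i. \<Sum>L | length L = i. prod_list (map2 Q K L) * (T (map P K) \<bullet> T' (map P L)))"
  using T
proof (induction i arbitrary: T T')
  case 0 then show ?case by simp
next
  case (Suc i)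
  have eV: "e j \<in> V" for j unfolding e sum_2 by (intro V)
  have lin: "S (e j # map P K) = (\<Sum>a\<in>UNIV. C j a *\<^sub>R S (P a # map P K))"
    if "multilinear_on (+) (*\<^sub>R) V (Suc i) S" "length K = i" for S :: "(real^3) list \<Rightarrow> 'w" and j K
    using multilinear_on_add[OF that(1), of "[]" "map P K" "C j 1 *\<^sub>R P 1" "C j 2 *\<^sub>R P 2"]
      multilinear_on_scale[OF that(1), of "[]" "map P K" "P 1" "C j 1"]
      multilinear_on_scale[OF that(1), of "[]" "map P K" "P 2" "C j 2"] that(2) V
    unfolding e sum_2 by auto
  have "(\<Sum>J | length J = Suc i. T (map e J) \<bullet> T' (map e J)) =
     (\<Sum>j\<in>UNIV. \<Sum>J | length J = i. T (e j # map e J) \<bullet> T' (e j # map e J))"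
    by (simp add: sum_lists_length_Suc)
  also have "\<dots> = (\<Sum>j\<in>UNIV. \<Sum>K | length K = i. \<Sum>L | length L = i.
      prod_list (map2 Q K L) * (T (e j # map P K) \<bullet> T' (e j # map P L)))"
    by (intro sum.cong refl Suc.IH multilinear_on_Cons Suc.prems eV)
  also have "\<dots> = (\<Sum>j\<in>UNIV. \<Sum>K | length K = i. \<Sum>L | length L = i.
      prod_list (map2 Q K L) * (\<Sum>a\<in>UNIV. \<Sum>b\<in>UNIV. C j a * C j b * (T (P a # map P K) \<bullet> T' (P b # map P L))))"
    using lin[OF Suc.prems(1)] lin[OF Suc.prems(2)]
    by (intro sum.cong refl) (simp add: sum_2 inner_add_left inner_add_right algebra_simps)
  also have "\<dots> = (\<Sum>a\<in>UNIV. \<Sum>K | length K = i. \<Sum>b\<in>UNIV. \<Sum>L | length L = i.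
      \<Sum>j\<in>UNIV. C j a * C j b * (prod_list (map2 Q K L) * (T (P a # map P K) \<bullet> T' (P b # map P L))))"
    unfolding sum_2 sum_distrib_left by (simp add: sum.distrib algebra_simps)
  also have "\<dots> = (\<Sum>a\<in>UNIV. \<Sum>K | length K = i. \<Sum>b\<in>UNIV. \<Sum>L | length L = i.
      prod_list (map2 Q (a # K) (b # L)) * (T (map P (a # K)) \<bullet> T' (map P (b # L))))"
    by (intro sum.cong refl) (simp add: Q sum_distrib_right[symmetric])
  finally show ?case by (simp add: sum_lists_length_Suc)
qed

text \<open>The chosen frame is the same term as in \<open>tensor_norm\<close>, so the relation to
  the norm and Cauchy-Schwarz hold at every point, whether or not an orthonormal frame exists
  there.\<close>

definition tensor_inner :: "metric \<Rightarrow> nat \<Rightarrow> real^3 \<Rightarrow> ((real^3) list \<Rightarrow> 'w::euclidean_space) \<Rightarrow> ((real^3) list \<Rightarrow> 'w) \<Rightarrow> real" where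
  "tensor_inner g i x t t' =
     (let e = (SOME e. orthonormal_frame g x e)
      in \<Sum>J | length J = i. t (map e J) \<bullet> t' (map e J))"

lemma tensor_norm_eq_sqrt: "tensor_norm g i x t = sqrt (tensor_inner g i x t t)"
  by (simp add: tensor_norm_def tensor_inner_def Let_def power2_norm_eq_inner)

lemma tensor_inner_nonneg: "tensor_inner g i x t t \<ge> 0"
  by (simp add: tensor_inner_def Let_def sum_nonneg)

lemma tensor_norm_nonneg: "tensor_norm g i x t \<ge> 0"
  by (simp add: tensor_norm_eq_sqrt tensor_inner_nonneg)

text \<open>The right-hand side no longer mentions a frame; measurability and invariance under
  changes on null sets are read off from it.\<close>

lemma tensor_inner_stereo:
  fixes T T' :: "'w::euclidean_space tensor_field"
  assumes g: "riemannian_metric g" and T: "tensor_field i T" "tensor_field i T'"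
  shows "tensor_inner g i (stereo s u) (T (stereo s u)) (T' (stereo s u)) =
    (\<Sum>K | length K = i. \<Sum>L | length L = i.
       prod_list (map2 (\<lambda>a b. matrix_inv (gram g s u) $ a $ b) K L) * (component s T K u \<bullet> component s T' L u))"
proof -
  define e where "e = (SOME e. orthonormal_frame g (stereo s u) e)"
  have e: "orthonormal_frame g (stereo s u) e"
    unfolding e_def using orthonormal_frame_exists[OF g] by (rule someI_ex)
  obtain C where "\<forall>i. e i = (\<Sum>j\<in>UNIV. C i j *\<^sub>R partial j (stereo s) u)"
    "\<forall>a b. (\<Sum>j\<in>UNIV. C j a * C j b) = matrix_inv (gram g s u) $ a $ b"
    using orthonormal_frame_expansion[OF g e] by (elim exE conjE)
  note C = this[rule_format]
  have T': "multilinear_on (+) (*\<^sub>R) (tangent (stereo s u)) i (T (stereo s u))"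
    "multilinear_on (+) (*\<^sub>R) (tangent (stereo s u)) i (T' (stereo s u))"
    using T[unfolded tensor_field_def, THEN bspec, OF stereo_in_S2] by simp_all
  show ?thesis
    unfolding tensor_inner_def Let_def e_def[symmetric] component_def
    by (rule sum_frame_change[OF C partial_stereo_tangent tangent_closed T'])
qed

section \<open>Measurability of the metric data and the volume measure in charts\<close>

lemma gram_measurable:
  assumes "riemannian_metric g"
  shows "(\<lambda>u. gram g s u $ i $ j) \<in> borel_measurable borel"
proof -
  have "Ck_on 0 UNIV (\<lambda>u. gram g s u $ i $ j)"
    using assms unfolding riemannian_metric_def smooth_on_def by blast
  then show ?thesis by (simp add: borel_measurable_continuous_onI)
qed

lemma partial_gram_measurable:
  assumes "riemannian_metric g"
  shows "(\<lambda>u. partial l (\<lambda>y. gram g s y $ i $ j) u) \<in> borel_measurable borel"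
proof -
  have "Ck_on (Suc 0) UNIV (\<lambda>u. gram g s u $ i $ j)"
    using assms unfolding riemannian_metric_def smooth_on_def by blast
  then show ?thesis unfolding partial_def by (simp add: borel_measurable_continuous_onI)
qed

lemma matrix_inv_gram_measurable:
  assumes g: "riemannian_metric g"
  shows "(\<lambda>u. matrix_inv (gram g s u) $ a $ b) \<in> borel_measurable borel"
proof -
  note [measurable] = gram_measurable[OF g]
  have "det (gram g s u) \<noteq> 0" for u using gram_positive(2)[OF g, of s u] by simp
  then show ?thesis
    by (subst matrix_inv_2, simp) (cases "a = b"; cases "a = 1"; simp add: det_2; measurable)
qed

lemma christoffel_measurable:
  assumes g: "riemannian_metric g"
  shows "(\<lambda>u. christoffel g s m i j u) \<in> borel_measurable borel"
proof -
  note [measurable] = partial_gram_measurable[OF g] matrix_inv_gram_measurable[OF g]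
  show ?thesis unfolding christoffel_def by measurable
qed

lemma sets_vol: "sets (vol g) = sets (restrict_space borel S2)"
  by (simp add: vol_def)

lemma space_vol: "space (vol g) = S2"
  by (simp add: vol_def space_restrict_space)

lemma sqrt_det_gram_measurable:
  assumes g: "riemannian_metric g"
  shows "(\<lambda>u. ennreal (sqrt (det (gram g s u)))) \<in> borel_measurable borel"
proof -
  note [measurable] = gram_measurable[OF g]
  show ?thesis unfolding det_2 by measurable
qed

text \<open>\<open>vol\<close> is the image of Lebesgue measure with an everywhere positive density,
  so null sets correspond.\<close>

lemma AE_vol_iff:
  assumes g: "riemannian_metric g"
  shows "(AE x in vol g. P x) \<longleftrightarrow> (AE u in lborel. P (stereo North u))"
proof -
  let ?d = "density lborel (\<lambda>u. ennreal (sqrt (det (gram g North u))))"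
  have m: "stereo North \<in> ?d \<rightarrow>\<^sub>M restrict_space borel S2"
    using stereo_measurable by simp
  have d: "(AE u in ?d. Q u) \<longleftrightarrow> (AE u in lborel. Q u)" for Q
    using gram_positive(2)[OF g] sqrt_det_gram_measurable[OF g, of North] by (simp add: AE_density)
  show ?thesis
  proof
    assume "AE x in vol g. P x"
    then have "AE u in ?d. P (stereo North u)" unfolding vol_def by (rule AE_distrD[OF m])
    then show "AE u in lborel. P (stereo North u)" using d by simp
  next
    assume "AE u in lborel. P (stereo North u)"
    \<comment> \<open>The set where \<open>P\<close> fails may be non-measurable, so it is enclosed
      in a Borel null set \<open>N\<close>, whose condition is transported through
      \<open>stereo_inv\<close> as a measurable one.\<close>
    then obtain N where N: "{u. \<not> P (stereo North u)} \<subseteq> N" "N \<in> sets lborel" "emeasure lborel N = 0"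
      by (auto elim!: AE_E)
    then have "N \<in> null_sets lborel" by auto
    then have "AE u in lborel. u \<notin> N" by (rule AE_not_in)
    then have ae: "AE u in ?d. stereo_inv (stereo North u) \<notin> N \<and> stereo North u \<noteq> north_pole"
      using d by (simp add: stereo_inv_stereo stereo_neq_north_pole)
    have "{x \<in> space (restrict_space borel S2). stereo_inv x \<notin> N \<and> x \<noteq> north_pole} \<in> sets (restrict_space borel S2)"
    proof -
      have [measurable]: "N \<in> sets borel" using N by simp
      have "{x. stereo_inv x \<notin> N \<and> x \<noteq> north_pole} \<in> sets borel" by measurable
      then have "S2 \<inter> {x. stereo_inv x \<notin> N \<and> x \<noteq> north_pole} \<in> sets (restrict_space borel S2)"
        by (auto simp: sets_restrict_space)
      moreover have "{x \<in> space (restrict_space borel S2). stereo_inv x \<notin> N \<and> x \<noteq> north_pole} =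
          S2 \<inter> {x. stereo_inv x \<notin> N \<and> x \<noteq> north_pole}" by (auto simp: space_restrict_space)
      ultimately show ?thesis by simp
    qed
    then have "AE x in vol g. stereo_inv x \<notin> N \<and> x \<noteq> north_pole"
      unfolding vol_def using ae by (rule iffD2[OF AE_distr_iff[OF m]])
    then show "AE x in vol g. P x"
      using AE_space
    proof eventually_elim
      case (elim x)
      then have "stereo North (stereo_inv x) = x" by (simp add: space_vol stereo_stereo_inv)
      then show ?case using elim N(1) by force
    qed
  qed
qed

lemma measurable_vol_imp_stereo:
  assumes "f \<in> borel_measurable (vol g)"
  shows "(\<lambda>u. f (stereo s u)) \<in> borel_measurable borel"
proof -
  have "f \<in> restrict_space borel S2 \<rightarrow>\<^sub>M borel"
    using assms measurable_cong_sets[OF sets_vol refl] by blast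
  then show ?thesis by (rule measurable_compose[OF stereo_measurable])
qed

text \<open>The northern chart misses a single point, and changing a Borel function at one point
  keeps it Borel.\<close>

lemma measurable_stereo_imp_vol:
  fixes f :: "real^3 \<Rightarrow> 'b::euclidean_space"
  assumes "(\<lambda>u. f (stereo North u)) \<in> borel_measurable borel"
  shows "f \<in> borel_measurable (vol g)"
proof -
  have [measurable]: "(\<lambda>x. f (stereo North (stereo_inv x))) \<in> borel_measurable borel"
    using measurable_compose[OF stereo_inv_measurable assms] .
  have "(\<lambda>x. if x = north_pole then f north_pole else f (stereo North (stereo_inv x))) \<in> borel_measurable borel"
    by measurable
  then have "(\<lambda>x. if x = north_pole then f north_pole else f (stereo North (stereo_inv x)))
      \<in> borel_measurable (restrict_space borel S2)"
    by (rule measurable_restrict_space1)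
  then have "f \<in> borel_measurable (restrict_space borel S2)"
    by (rule measurable_cong[THEN iffD1, rotated]) (auto simp: space_restrict_space stereo_stereo_inv)
  then show ?thesis using measurable_cong_sets[OF sets_vol refl] by blast
qed

section \<open>Measurable tensor fields and equality almost everywhere\<close>

definition measurable_tensor :: "nat \<Rightarrow> 'w::euclidean_space tensor_field \<Rightarrow> bool" where
  "measurable_tensor i T \<longleftrightarrow> tensor_field i T \<and>
     (\<forall>s J. length J = i \<longrightarrow> component s T J \<in> borel_measurable borel)"

text \<open>Both charts are included because \<open>weak_cov_deriv\<close> tests the components in
  both.\<close>

definition tensor_AE_eq :: "nat \<Rightarrow> 'w tensor_field \<Rightarrow> 'w tensor_field \<Rightarrow> bool" where
  "tensor_AE_eq i T T' \<longleftrightarrow>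
     (\<forall>s J. length J = i \<longrightarrow> (AE u in lborel. component s T J u = component s T' J u))"

lemma prod_list_map2_measurable:
  assumes "\<And>a b. (\<lambda>u. Q a b u) \<in> borel_measurable M"
  shows "(\<lambda>u. prod_list (map2 (\<lambda>a b. Q a b u :: real) K L)) \<in> borel_measurable M"
proof (induction K arbitrary: L)
  case (Cons a K)
  then show ?case using assms by (cases L) auto
qed simp

lemma tensor_inner_measurable:
  fixes T T' :: "'w::euclidean_space tensor_field"
  assumes g: "riemannian_metric g" and T: "measurable_tensor i T" "measurable_tensor i T'"
  shows "(\<lambda>x. tensor_inner g i x (T x) (T' x)) \<in> borel_measurable (vol g)"
proof (rule measurable_stereo_imp_vol)
  have tf: "tensor_field i T" "tensor_field i T'" using T by (auto simp: measurable_tensor_def)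
  show "(\<lambda>u. tensor_inner g i (stereo North u) (T (stereo North u)) (T' (stereo North u))) \<in> borel_measurable borel"
    unfolding tensor_inner_stereo[OF g tf]
    using T unfolding measurable_tensor_def
    by (intro borel_measurable_sum borel_measurable_times borel_measurable_inner
        prod_list_map2_measurable matrix_inv_gram_measurable[OF g]) auto
qed

lemma tensor_inner_AE_cong:
  fixes T1 T2 :: "'w::euclidean_space tensor_field"
  assumes g: "riemannian_metric g"
    and tf: "tensor_field i T1" "tensor_field i T2" "tensor_field i T1'" "tensor_field i T2'"
    and eq: "tensor_AE_eq i T1 T1'" "tensor_AE_eq i T2 T2'"
  shows "AE x in vol g. tensor_inner g i x (T1 x) (T2 x) = tensor_inner g i x (T1' x) (T2' x)"
proof -
  have "AE u in lborel. \<forall>J\<in>{J. length J = i}. component North T1 J u = component North T1' J u"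
    "AE u in lborel. \<forall>J\<in>{J. length J = i}. component North T2 J u = component North T2' J u"
    using eq unfolding tensor_AE_eq_def AE_finite_all[OF finite_lists_length] by simp_all
  then have "AE u in lborel. tensor_inner g i (stereo North u) (T1 (stereo North u)) (T2 (stereo North u)) =
     tensor_inner g i (stereo North u) (T1' (stereo North u)) (T2' (stereo North u))"
  proof eventually_elim
    case (elim u)
    then show ?case
      unfolding tensor_inner_stereo[OF g tf(1,2)] tensor_inner_stereo[OF g tf(3,4)]
      by (intro sum.cong refl) simp
  qed
  then show ?thesis by (simp add: AE_vol_iff[OF g])
qed

lemma tensor_field_lincomb:
  fixes T1 T2 :: "'w::real_vector tensor_field"
  assumes "tensor_field i T1" "tensor_field i T2"
  shows "tensor_field i (\<lambda>x vs. a *\<^sub>R T1 x vs + b *\<^sub>R T2 x vs)"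
  unfolding tensor_field_def
proof
  fix x assume x: "x \<in> S2"
  note T1 = assms(1)[unfolded tensor_field_def, THEN bspec, OF x]
    and T2 = assms(2)[unfolded tensor_field_def, THEN bspec, OF x]
  show "multilinear_on (+) (*\<^sub>R) (tangent x) i (\<lambda>vs. a *\<^sub>R T1 x vs + b *\<^sub>R T2 x vs)"
    unfolding multilinear_on_def
    by (auto simp: multilinear_onD[OF T1] multilinear_onD[OF T2] algebra_simps)
qed

lemma component_lincomb:
  "component s (\<lambda>x vs. a *\<^sub>R T1 x vs + b *\<^sub>R T2 x vs) J u = a *\<^sub>R component s T1 J u + b *\<^sub>R component s T2 J u"
  by (simp add: component_def)

lemma measurable_tensor_lincomb:
  assumes "measurable_tensor i T1" "measurable_tensor i T2"
  shows "measurable_tensor i (\<lambda>x vs. a *\<^sub>R T1 x vs + b *\<^sub>R T2 x vs)"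
  using assms unfolding measurable_tensor_def
  by (auto intro!: tensor_field_lincomb borel_measurable_add borel_measurable_scaleR
      simp: component_lincomb[abs_def])

lemma tensor_inner_lincomb_left:
  "tensor_inner g i x (\<lambda>vs. a *\<^sub>R t1 vs + b *\<^sub>R t2 vs) t = a * tensor_inner g i x t1 t + b * tensor_inner g i x t2 t"
  by (simp add: tensor_inner_def Let_def inner_add_left sum.distrib sum_distrib_left)

lemma tensor_inner_commute: "tensor_inner g i x t t' = tensor_inner g i x t' t"
  by (simp add: tensor_inner_def Let_def inner_commute)

lemma tensor_norm_eq_L2_set:
  "tensor_norm g i x t = L2_set (\<lambda>J. norm (t (map (SOME e. orthonormal_frame g x e) J))) {J. length J = i}"
  by (simp add: tensor_norm_def L2_set_def Let_def)

lemma tensor_inner_le_norm: "\<bar>tensor_inner g i x t t'\<bar> \<le> tensor_norm g i x t * tensor_norm g i x t'"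
proof -
  let ?e = "SOME e. orthonormal_frame g x e"
  have "\<bar>tensor_inner g i x t t'\<bar> \<le> (\<Sum>J | length J = i. \<bar>norm (t (map ?e J))\<bar> * \<bar>norm (t' (map ?e J))\<bar>)"
    unfolding tensor_inner_def Let_def
    by (intro order.trans[OF sum_abs] sum_mono) (simp add: Cauchy_Schwarz_ineq2)
  also have "\<dots> \<le> tensor_norm g i x t * tensor_norm g i x t'"
    unfolding tensor_norm_eq_L2_set by (rule L2_set_mult_ineq)
  finally show ?thesis .
qed

lemma tensor_norm_lincomb_le:
  "tensor_norm g i x (\<lambda>vs. a *\<^sub>R t1 vs + b *\<^sub>R t2 vs) \<le> \<bar>a\<bar> * tensor_norm g i x t1 + \<bar>b\<bar> * tensor_norm g i x t2"
proof -
  let ?e = "SOME e. orthonormal_frame g x e"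
  have "tensor_norm g i x (\<lambda>vs. a *\<^sub>R t1 vs + b *\<^sub>R t2 vs) \<le>
    L2_set (\<lambda>J. \<bar>a\<bar> * norm (t1 (map ?e J)) + \<bar>b\<bar> * norm (t2 (map ?e J))) {J. length J = i}"
    unfolding tensor_norm_eq_L2_set
    by (intro L2_set_mono) (auto intro: order.trans[OF norm_triangle_ineq])
  also have "\<dots> \<le> L2_set (\<lambda>J. \<bar>a\<bar> * norm (t1 (map ?e J))) {J. length J = i}
    + L2_set (\<lambda>J. \<bar>b\<bar> * norm (t2 (map ?e J))) {J. length J = i}"
    by (rule L2_set_triangle_ineq)
  also have "\<dots> = \<bar>a\<bar> * tensor_norm g i x t1 + \<bar>b\<bar> * tensor_norm g i x t2"
    unfolding tensor_norm_eq_L2_set by (simp add: L2_set_right_distrib)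
  finally show ?thesis .
qed

section \<open>Linearity of the weak covariant derivatives\<close>

text \<open>A weak partial derivative is locally integrable, hence Borel; subtracting the measurable
  Christoffel terms leaves the component of \<open>T'\<close>.\<close>

lemma weak_cov_deriv_measurable:
  assumes g: "riemannian_metric g" and T: "measurable_tensor i T" and w: "weak_cov_deriv g i T T'"
  shows "measurable_tensor (Suc i) T'"
  unfolding measurable_tensor_def
proof (intro conjI allI impI)
  show "tensor_field (Suc i) T'" using w by (simp add: weak_cov_deriv_def)
  fix s and K :: "2 list" assume "length K = Suc i"
  then obtain j J where K: "K = j # J" "length J = i" by (auto simp: length_Suc_conv)
  let ?\<Gamma> = "\<lambda>u. \<Sum>l<i. \<Sum>m\<in>UNIV. christoffel g s m j (J ! l) u *\<^sub>R component s T (J[l := m]) u"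
  have "?\<Gamma> \<in> borel_measurable borel"
    using T K(2) unfolding measurable_tensor_def
    by (intro borel_measurable_sum borel_measurable_scaleR christoffel_measurable[OF g]) auto
  moreover have "(\<lambda>u. component s T' K u + ?\<Gamma> u) \<in> borel_measurable borel"
    using w K unfolding weak_cov_deriv_def weak_partial_def by (auto intro: locally_integrable_measurable)
  ultimately have "(\<lambda>u. (component s T' K u + ?\<Gamma> u) - ?\<Gamma> u) \<in> borel_measurable borel"
    by (intro borel_measurable_diff)
  then show "component s T' K \<in> borel_measurable borel" by simp
qed

text \<open>The Christoffel terms involve \<open>T\<close> alone, so they cancel from two weak
  derivatives of the same component.\<close>

lemma weak_cov_deriv_unique:
  assumes "weak_cov_deriv g i T T1" "weak_cov_deriv g i T T2"
  shows "tensor_AE_eq (Suc i) T1 T2"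
  unfolding tensor_AE_eq_def
proof (intro allI impI)
  fix s and K :: "2 list" assume "length K = Suc i"
  then obtain j J where K: "K = j # J" "length J = i" by (auto simp: length_Suc_conv)
  let ?\<Gamma> = "\<lambda>u. \<Sum>l<i. \<Sum>m\<in>UNIV. christoffel g s m j (J ! l) u *\<^sub>R component s T (J[l := m]) u"
  have "weak_partial j (component s T J) (\<lambda>u. component s T1 K u + ?\<Gamma> u)"
    "weak_partial j (component s T J) (\<lambda>u. component s T2 K u + ?\<Gamma> u)"
    using assms K unfolding weak_cov_deriv_def by blast+
  then have "AE u in lborel. component s T1 K u + ?\<Gamma> u = component s T2 K u + ?\<Gamma> u"
    by (rule weak_partial_unique)
  then show "AE u in lborel. component s T1 K u = component s T2 K u" by simp
qed

text \<open>\<open>T\<close> stands for the field chosen by \<open>nabla\<close>, known to be the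
  combination only almost everywhere; the measurability hypotheses make weak differentiation
  insensitive to the difference.\<close>

lemma weak_cov_deriv_lincomb:
  fixes T T1 T2 :: "'w::euclidean_space tensor_field"
  assumes g: "riemannian_metric g"
    and w: "weak_cov_deriv g i T1 T1'" "weak_cov_deriv g i T2 T2'"
    and m: "measurable_tensor i T" "measurable_tensor (Suc i) T1'" "measurable_tensor (Suc i) T2'"
    and eq: "tensor_AE_eq i T (\<lambda>x vs. a *\<^sub>R T1 x vs + b *\<^sub>R T2 x vs)"
  shows "weak_cov_deriv g i T (\<lambda>x vs. a *\<^sub>R T1' x vs + b *\<^sub>R T2' x vs)" (is "weak_cov_deriv g i T ?T'")
  unfolding weak_cov_deriv_def
proof (intro conjI allI impI)
  show "tensor_field (Suc i) ?T'"
    using w by (intro tensor_field_lincomb) (auto simp: weak_cov_deriv_def)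
  fix s j and J :: "2 list" assume J: "length J = i"
  let ?\<Gamma> = "\<lambda>T u. \<Sum>l<i. \<Sum>m\<in>UNIV. christoffel g s m j (J ! l) u *\<^sub>R component s T (J[l := m]) u"
  have AE: "AE u in lborel. \<forall>K\<in>{K. length K = i}.
       component s T K u = a *\<^sub>R component s T1 K u + b *\<^sub>R component s T2 K u"
    using eq unfolding tensor_AE_eq_def component_lincomb AE_finite_all[OF finite_lists_length] by simp
  show "weak_partial j (component s T J) (\<lambda>u. component s ?T' (j # J) u + ?\<Gamma> T u)"
  proof (rule weak_partial_cong_AE)
    show "weak_partial j (\<lambda>u. a *\<^sub>R component s T1 J u + b *\<^sub>R component s T2 J u)
       (\<lambda>u. a *\<^sub>R (component s T1' (j # J) u + ?\<Gamma> T1 u) + b *\<^sub>R (component s T2' (j # J) u + ?\<Gamma> T2 u))"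
      using w J unfolding weak_cov_deriv_def by (intro weak_partial_lincomb) blast+
    show "AE u in lborel. component s T J u = a *\<^sub>R component s T1 J u + b *\<^sub>R component s T2 J u"
      using AE by eventually_elim (use J in simp)
    show "component s T J \<in> borel_measurable borel"
      using m(1) J by (simp add: measurable_tensor_def)
    show "AE u in lborel. component s ?T' (j # J) u + ?\<Gamma> T u =
       a *\<^sub>R (component s T1' (j # J) u + ?\<Gamma> T1 u) + b *\<^sub>R (component s T2' (j # J) u + ?\<Gamma> T2 u)"
      using AE
    proof eventually_elim
      case (elim u)
      have "?\<Gamma> T u = (\<Sum>l<i. \<Sum>m\<in>UNIV. a *\<^sub>R (christoffel g s m j (J ! l) u *\<^sub>R component s T1 (J[l := m]) u)
         + b *\<^sub>R (christoffel g s m j (J ! l) u *\<^sub>R component s T2 (J[l := m]) u))"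
        using elim J by (intro sum.cong refl) (simp add: scaleR_add_right mult.commute)
      also have "\<dots> = a *\<^sub>R ?\<Gamma> T1 u + b *\<^sub>R ?\<Gamma> T2 u"
        by (simp only: sum.distrib scaleR_sum_right)
      finally show ?case by (simp only: component_lincomb scaleR_add_right add_ac)
    qed
    show "(\<lambda>u. component s ?T' (j # J) u + ?\<Gamma> T u) \<in> borel_measurable borel"
      using m J measurable_tensor_lincomb[OF m(2,3), of a b] unfolding measurable_tensor_def
      by (intro borel_measurable_add borel_measurable_sum borel_measurable_scaleR christoffel_measurable[OF g]) auto
  qed
qed

text \<open>\<open>sobolev_fun\<close> without integrability: this part can be propagated one order
  at a time.\<close>

definition weakly_differentiable :: "metric \<Rightarrow> nat \<Rightarrow> (real^3 \<Rightarrow> 'w::euclidean_space) \<Rightarrow> bool" where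
  "weakly_differentiable g k f \<longleftrightarrow> f \<in> borel_measurable (vol g) \<and>
     (\<forall>i<k. \<exists>T'. weak_cov_deriv g i (nabla g f i) T')"

lemma weak_cov_deriv_nabla:
  assumes "weakly_differentiable g k f" "i < k"
  shows "weak_cov_deriv g i (nabla g f i) (nabla g f (Suc i))"
proof -
  have "\<exists>T'. weak_cov_deriv g i (nabla g f i) T'"
    using assms unfolding weakly_differentiable_def by simp
  then show ?thesis unfolding nabla.simps by (rule someI_ex)
qed

lemma measurable_tensor_nabla:
  assumes g: "riemannian_metric g" and f: "weakly_differentiable g k f"
  shows "i \<le> k \<Longrightarrow> measurable_tensor i (nabla g f i)"
proof (induction i)
  case 0
  have "(\<lambda>u. f (stereo s u)) \<in> borel_measurable borel" for s
    using f measurable_vol_imp_stereo unfolding weakly_differentiable_def by blast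
  then show ?case
    by (simp add: measurable_tensor_def tensor_field_def multilinear_on_def component_def[abs_def])
next
  case (Suc i)
  then show ?case
    using weak_cov_deriv_measurable[OF g _ weak_cov_deriv_nabla[OF f]] by simp
qed

text \<open>The two claims feed each other: the comparison at order \<open>i\<close> yields a
  derivative at the next order, and once one exists, uniqueness identifies the one chosen by
  \<open>nabla\<close> with the combination.\<close>

lemma nabla_lincomb_aux:
  fixes f f1 f2 :: "real^3 \<Rightarrow> 'w::euclidean_space"
  assumes g: "riemannian_metric g" and f: "f \<in> borel_measurable (vol g)"
    and wd: "weakly_differentiable g k f1" "weakly_differentiable g k f2"
    and eq: "AE x in vol g. f x = a *\<^sub>R f1 x + b *\<^sub>R f2 x"
  shows "i \<le> k \<Longrightarrow> weakly_differentiable g i f \<and>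
     tensor_AE_eq i (nabla g f i) (\<lambda>x vs. a *\<^sub>R nabla g f1 i x vs + b *\<^sub>R nabla g f2 i x vs)"
proof (induction i)
  case 0
  have N: "AE u in lborel. f (stereo North u) = a *\<^sub>R f1 (stereo North u) + b *\<^sub>R f2 (stereo North u)"
    using eq AE_vol_iff[OF g] by simp
  \<comment> \<open>The hypothesis lives on \<open>vol\<close> and so on the northern chart;
    inversion carries it to the southern one.\<close>
  have "AE u in lborel. f (stereo s u) = a *\<^sub>R f1 (stereo s u) + b *\<^sub>R f2 (stereo s u)" for s
    using N AE_stereo_North_imp_South[OF N] by (cases s) auto
  then show ?case using f
    by (simp add: weakly_differentiable_def tensor_AE_eq_def component_def)
next
  case (Suc i)
  then have IH: "weakly_differentiable g i f"
    "tensor_AE_eq i (nabla g f i) (\<lambda>x vs. a *\<^sub>R nabla g f1 i x vs + b *\<^sub>R nabla g f2 i x vs)" by auto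
  have "i < k" using Suc.prems by simp
  have w: "weak_cov_deriv g i (nabla g f i) (\<lambda>x vs. a *\<^sub>R nabla g f1 (Suc i) x vs + b *\<^sub>R nabla g f2 (Suc i) x vs)"
    using \<open>i < k\<close>
    by (intro weak_cov_deriv_lincomb[OF g weak_cov_deriv_nabla[OF wd(1)] weak_cov_deriv_nabla[OF wd(2)]]
        measurable_tensor_nabla[OF g IH(1)] measurable_tensor_nabla[OF g wd(1)]
        measurable_tensor_nabla[OF g wd(2)] IH(2)) auto
  then have wd': "weakly_differentiable g (Suc i) f"
    using IH(1) unfolding weakly_differentiable_def less_Suc_eq by blast
  have "weak_cov_deriv g i (nabla g f i) (nabla g f (Suc i))"
    by (rule weak_cov_deriv_nabla[OF wd']) simp
  then show ?case using wd' weak_cov_deriv_unique[OF _ w] by blast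
qed

lemma weakly_differentiable_lincomb:
  fixes f f1 f2 :: "real^3 \<Rightarrow> 'w::euclidean_space"
  assumes "riemannian_metric g" "f \<in> borel_measurable (vol g)"
    "weakly_differentiable g k f1" "weakly_differentiable g k f2"
    "AE x in vol g. f x = a *\<^sub>R f1 x + b *\<^sub>R f2 x"
  shows "weakly_differentiable g k f"
  using nabla_lincomb_aux[OF assms order.refl] by blast

lemma nabla_lincomb:
  fixes f f1 f2 :: "real^3 \<Rightarrow> 'w::euclidean_space"
  assumes "riemannian_metric g" "f \<in> borel_measurable (vol g)"
    "weakly_differentiable g k f1" "weakly_differentiable g k f2"
    "AE x in vol g. f x = a *\<^sub>R f1 x + b *\<^sub>R f2 x" "i \<le> k"
  shows "tensor_AE_eq i (nabla g f i) (\<lambda>x vs. a *\<^sub>R nabla g f1 i x vs + b *\<^sub>R nabla g f2 i x vs)"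
  using nabla_lincomb_aux[OF assms] by blast

section \<open>Integrals of products of tensors\<close>

text \<open>Neighbours are paired: \<open>q v1 v2 * q v3 v4 * ...\<close>. A leftover last entry of
  an odd list is dropped by the default 1, hence the parity assumptions below.\<close>

fun paired_product :: "('v \<Rightarrow> 'v \<Rightarrow> real) \<Rightarrow> 'v list \<Rightarrow> real" where
  "paired_product q (a # b # vs) = q a b * paired_product q vs"
| "paired_product q _ = 1"

lemma paired_product_replicate: "paired_product q (replicate (2 * m) v) = q v v ^ m"
  by (induction m) auto

text \<open>Even total length guarantees \<open>v\<close> a partner, so exactly one factor contains
  it. Linearity is assumed on both sides of \<open>q\<close> because \<open>v\<close> may come first
  or second in its pair.\<close>

lemma paired_product_lincomb:
  assumes "even (length xs + 1 + length ys)"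
    and "\<And>s. s \<in> set xs \<union> set ys \<Longrightarrow> q v s = a * q v1 s + b * q v2 s"
    and "\<And>s. s \<in> set xs \<union> set ys \<Longrightarrow> q s v = a * q s v1 + b * q s v2"
  shows "paired_product q (xs @ v # ys) =
     a * paired_product q (xs @ v1 # ys) + b * paired_product q (xs @ v2 # ys)"
  using assms
proof (induction xs rule: induct_list012)
  case 1
  then show ?case by (cases ys) (auto simp: algebra_simps)
next
  case (2 x)
  then show ?case by (auto simp: algebra_simps)
next
  case (3 x y zs)
  then have "paired_product q (zs @ v # ys) =
     a * paired_product q (zs @ v1 # ys) + b * paired_product q (zs @ v2 # ys)" by simp
  then show ?case by (simp add: algebra_simps)
qed

lemma paired_product_le:
  assumes "even (length vs)" and q: "\<And>v w. \<bar>q v w\<bar> \<le> n v * n w" and n: "\<And>v. (0::real) \<le> n v"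
  shows "\<bar>paired_product q vs\<bar> \<le> prod_list (map n vs)"
  using assms(1)
proof (induction vs rule: induct_list012)
  case (3 x y zs)
  have "\<bar>q x y\<bar> * \<bar>paired_product q zs\<bar> \<le> (n x * n y) * prod_list (map n zs)"
    using 3 n by (intro mult_mono q mult_nonneg_nonneg) auto
  then show ?case by (simp add: abs_mult mult.assoc)
qed auto

lemma paired_product_measurable:
  assumes "\<And>v w. v \<in> set vs \<Longrightarrow> w \<in> set vs \<Longrightarrow> (\<lambda>x. q x v w) \<in> borel_measurable M"
  shows "(\<lambda>x. paired_product (q x) vs) \<in> borel_measurable M"
  using assms by (induction vs rule: induct_list012) auto

text \<open>Every factor is at most the largest one, whose power is itself one of the
  summands.\<close>

lemma prod_list_le_sum_list_power:
  fixes n :: "'v \<Rightarrow> real"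
  assumes n: "\<And>v. v \<in> set vs \<Longrightarrow> 0 \<le> n v" and "vs \<noteq> []"
  shows "prod_list (map n vs) \<le> sum_list (map (\<lambda>v. n v ^ length vs) vs)"
proof -
  define m where "m = Max (n ` set vs)"
  have m: "n v \<le> m" if "v \<in> set vs" for v
    unfolding m_def using that by (intro Max_ge) auto
  have "prod_list (map n us) \<le> m ^ length us" if "set us \<subseteq> set vs" for us
    using that
  proof (induction us)
    case (Cons u us)
    then show ?case using m n
      by (auto intro!: mult_mono prod_list_map_nonneg order.trans[OF n m])
  qed simp
  then have "prod_list (map n vs) \<le> m ^ length vs" by simp
  moreover have "m \<in> n ` set vs" unfolding m_def using assms(2) by (intro Max_in) auto
  then obtain v where v: "v \<in> set vs" "m = n v" by blast
  then have "m ^ length vs \<le> sum_list (map (\<lambda>v. n v ^ length vs) vs)"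
    using n by (intro member_le_sum_list) auto
  ultimately show ?thesis by linarith
qed

text \<open>
  After normalization the product is bounded by the sum of the \<open>p\<close>-th powers of its factors; the
  cost of this shortcut to Hoelder's inequality is the factor \<open>p\<close>.
\<close>

lemma integral_prod_list_bound:
  fixes F :: "'a \<Rightarrow> real" and n :: "'v \<Rightarrow> 'a \<Rightarrow> real"
  assumes len: "length vs = p" "p > 0"
    and F: "F \<in> borel_measurable M" "\<And>x. \<bar>F x\<bar> \<le> prod_list (map (\<lambda>v. n v x) vs)"
    and n: "\<And>v x. 0 \<le> n v x" "\<And>v. v \<in> set vs \<Longrightarrow> integrable M (\<lambda>x. n v x ^ p)"
    and c: "\<And>v. v \<in> set vs \<Longrightarrow> 0 \<le> c v" "\<And>v. v \<in> set vs \<Longrightarrow> (LINT x|M. n v x ^ p) \<le> c v ^ p"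
  shows "integrable M F" "\<bar>LINT x|M. F x\<bar> \<le> real p * prod_list (map c vs)"
proof -
  have sum_int: "integrable M (\<lambda>x. sum_list (map (\<lambda>v. d v * n v x ^ p) us))"
    "(LINT x|M. sum_list (map (\<lambda>v. d v * n v x ^ p) us)) = sum_list (map (\<lambda>v. d v * (LINT x|M. n v x ^ p)) us)"
    if "set us \<subseteq> set vs" for us d
    using that by (induction us) (auto simp: n)
  have "vs \<noteq> []" using len by auto
  have b: "\<bar>F x\<bar> \<le> sum_list (map (\<lambda>v. 1 * n v x ^ p) vs)" for x
    using F(2)[of x] prod_list_le_sum_list_power[of vs "\<lambda>v. n v x"] n(1) \<open>vs \<noteq> []\<close> len by fastforce
  show int: "integrable M F"
    by (rule Bochner_Integration.integrable_bound[OF sum_int(1)[OF order.refl, of "\<lambda>_. 1"] F(1)])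
       (use b in \<open>auto intro: order.trans[OF _ abs_ge_self]\<close>)
  show "\<bar>LINT x|M. F x\<bar> \<le> real p * prod_list (map c vs)"
  \<comment> \<open>Normalizing divides by \<open>c v\<close>. If some \<open>c v\<close> is zero,
    the integral of the corresponding power is zero, so that factor and with it \<open>F\<close>
    vanish almost everywhere.\<close>
  proof (cases "\<exists>v\<in>set vs. c v = 0")
    case True
    then obtain v where v: "v \<in> set vs" "c v = 0" by blast
    have "(LINT x|M. n v x ^ p) = 0"
      using c(2)[OF v(1)] v(2) len(2) n(1)
      by (intro antisym Bochner_Integration.integral_nonneg) (simp_all add: zero_power)
    then have "AE x in M. n v x ^ p = 0"
      using integral_nonneg_eq_0_iff_AE[OF n(2)[OF v(1)]] n(1) by auto
    then have "AE x in M. F x = 0"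
    proof eventually_elim
      case (elim x)
      then have "0 \<in> set (map (\<lambda>v. n v x) vs)" using v(1) by force
      then have "prod_list (map (\<lambda>v. n v x) vs) = 0" by (simp add: prod_list_zero_iff)
      then show ?case using F(2)[of x] by simp
    qed
    then have "(LINT x|M. F x) = 0" using integral_eq_zero_AE by blast
    moreover have "prod_list (map c vs) \<ge> 0" using c by (intro prod_list_map_nonneg)
    ultimately show ?thesis by simp
  next
    case False
    then have pos: "c v > 0" if "v \<in> set vs" for v using c(1)[OF that] that by force
    let ?P = "prod_list (map c vs)"
    have P: "?P \<ge> 0" using c by (intro prod_list_map_nonneg)
    have fac: "prod_list (map (\<lambda>v. n v x) us) = prod_list (map c us) * prod_list (map (\<lambda>v. n v x / c v) us)"
      if "set us \<subseteq> set vs" for us x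
      using that by (induction us) (use pos in \<open>auto simp: less_imp_neq[symmetric]\<close>)
    have bx: "\<bar>F x\<bar> \<le> ?P * sum_list (map (\<lambda>v. 1 / c v ^ p * n v x ^ p) vs)" for x
    proof -
      have "\<bar>F x\<bar> \<le> ?P * prod_list (map (\<lambda>v. n v x / c v) vs)" using F(2)[of x] fac[of vs x] by simp
      also have "\<dots> \<le> ?P * sum_list (map (\<lambda>v. (n v x / c v) ^ length vs) vs)"
        using n(1) c(1) \<open>vs \<noteq> []\<close> P by (intro mult_left_mono prod_list_le_sum_list_power) auto
      finally show ?thesis using len by (simp add: power_divide)
    qed
    have "\<bar>LINT x|M. F x\<bar> \<le> (LINT x|M. \<bar>F x\<bar>)" by (rule integral_abs_bound)
    also have "\<dots> \<le> (LINT x|M. ?P * sum_list (map (\<lambda>v. 1 / c v ^ p * n v x ^ p) vs))"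
      by (intro integral_mono integrable_abs[OF int] integrable_mult_right sum_int(1) order.refl bx)
    also have "\<dots> = ?P * sum_list (map (\<lambda>v. 1 / c v ^ p * (LINT x|M. n v x ^ p)) vs)"
      using sum_int(2)[OF order.refl, of "\<lambda>v. 1 / c v ^ p"] by simp
    \<comment> \<open>Each normalized integral is at most 1, and there are \<open>p\<close> of
      them.\<close>
    also have "\<dots> \<le> ?P * sum_list (map (\<lambda>v. 1) vs)"
      using P pos c by (intro mult_left_mono sum_list_mono) (auto simp: field_simps)
    also have "\<dots> = real p * ?P" using len by (simp add: sum_list_triv)
    finally show ?thesis .
  qed
qed

section \<open>Sobolev functions, their classes and the energy\<close>

lemma sobolev_fun_iff:
  "f \<in> sobolev_fun g k p \<longleftrightarrow> weakly_differentiable g k f \<and>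
     (\<forall>i\<le>k. integrable (vol g) (\<lambda>x. tensor_norm g i x (nabla g f i x) ^ p))"
  by (auto simp: sobolev_fun_def weakly_differentiable_def)

lemma sobolev_fun_weakly_differentiable: "f \<in> sobolev_fun g k p \<Longrightarrow> weakly_differentiable g k f"
  by (simp add: sobolev_fun_iff)

lemma add_power_le:
  fixes x y :: real
  assumes "0 \<le> x" "0 \<le> y"
  shows "(x + y) ^ p \<le> 2 ^ p * (x ^ p + y ^ p)"
proof -
  have "(x + y) ^ p \<le> (2 * max x y) ^ p" using assms by (intro power_mono) auto
  also have "\<dots> = 2 ^ p * max x y ^ p" by (rule power_mult_distrib)
  also have "max x y ^ p \<le> x ^ p + y ^ p" using assms by (auto simp: max_def)
  finally show ?thesis by simp
qed

lemma measurable_tensor_field: "measurable_tensor i T \<Longrightarrow> tensor_field i T"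
  by (simp add: measurable_tensor_def)

context
  fixes g :: metric and k p :: nat
  assumes g: "riemannian_metric g"
begin

lemma tensor_norm_measurable:
  fixes T :: "'w::euclidean_space tensor_field"
  assumes "measurable_tensor i T"
  shows "(\<lambda>x. tensor_norm g i x (T x)) \<in> borel_measurable (vol g)"
  unfolding tensor_norm_eq_sqrt using tensor_inner_measurable[OF g assms assms] by measurable

lemma sobolev_fun_measurable_tensor:
  assumes "f \<in> sobolev_fun g k p" "i \<le> k"
  shows "measurable_tensor i (nabla g f i)"
  by (rule measurable_tensor_nabla[OF g sobolev_fun_weakly_differentiable[OF assms(1)] assms(2)])

lemma sobolev_fun_nabla_lincomb:
  fixes f f1 f2 :: "real^3 \<Rightarrow> real^'m"
  assumes f: "f1 \<in> sobolev_fun g k p" "f2 \<in> sobolev_fun g k p" "f \<in> borel_measurable (vol g)"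
    and eq: "AE x in vol g. f x = a *\<^sub>R f1 x + b *\<^sub>R f2 x" and i: "i \<le> k"
  shows "tensor_AE_eq i (nabla g f i) (\<lambda>x vs. a *\<^sub>R nabla g f1 i x vs + b *\<^sub>R nabla g f2 i x vs)"
  by (rule nabla_lincomb[OF g f(3) f(1,2)[THEN sobolev_fun_weakly_differentiable] eq i])

text \<open>One statement covers sums, multiples and modification on a null set. Integrability comes
  from the pointwise triangle inequality, applied where the chosen derivatives of \<open>f\<close>
  agree with the combination.\<close>

lemma sobolev_fun_lincomb:
  fixes f f1 f2 :: "real^3 \<Rightarrow> real^'m"
  assumes f: "f1 \<in> sobolev_fun g k p" "f2 \<in> sobolev_fun g k p" "f \<in> borel_measurable (vol g)"
    and eq: "AE x in vol g. f x = a *\<^sub>R f1 x + b *\<^sub>R f2 x"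
  shows "f \<in> sobolev_fun g k p"
  unfolding sobolev_fun_iff
proof (intro conjI allI impI)
  show wd: "weakly_differentiable g k f"
    by (rule weakly_differentiable_lincomb[OF g f(3) f(1,2)[THEN sobolev_fun_weakly_differentiable] eq])
  fix i assume i: "i \<le> k"
  let ?T = "nabla g f i" and ?T1 = "nabla g f1 i" and ?T2 = "nabla g f2 i"
  let ?L = "\<lambda>x vs. a *\<^sub>R ?T1 x vs + b *\<^sub>R ?T2 x vs"
  note mt = measurable_tensor_nabla[OF g wd i] sobolev_fun_measurable_tensor[OF f(1) i] sobolev_fun_measurable_tensor[OF f(2) i]
  note eqT = sobolev_fun_nabla_lincomb[OF f eq i]
  have tf: "tensor_field i ?T" "tensor_field i ?L"
    using measurable_tensor_field[OF mt(1)] measurable_tensor_field[OF measurable_tensor_lincomb[OF mt(2,3)]]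
    by this+
  let ?B = "\<lambda>x. 2 ^ p * (\<bar>a\<bar> ^ p * tensor_norm g i x (?T1 x) ^ p + \<bar>b\<bar> ^ p * tensor_norm g i x (?T2 x) ^ p)"
  show "integrable (vol g) (\<lambda>x. tensor_norm g i x (?T x) ^ p)"
  proof (rule Bochner_Integration.integrable_bound)
    show "integrable (vol g) ?B"
      using f i unfolding sobolev_fun_iff by auto
    show "(\<lambda>x. tensor_norm g i x (?T x) ^ p) \<in> borel_measurable (vol g)"
      using tensor_norm_measurable[OF mt(1)] by simp
    show "AE x in vol g. norm (tensor_norm g i x (?T x) ^ p) \<le> norm (?B x)"
      using tensor_inner_AE_cong[OF g tf(1) tf(1) tf(2) tf(2) eqT eqT]
    proof eventually_elim
      case (elim x)
      have "tensor_norm g i x (?T x) = tensor_norm g i x (?L x)"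
        using elim by (simp add: tensor_norm_eq_sqrt)
      also have "\<dots> \<le> \<bar>a\<bar> * tensor_norm g i x (?T1 x) + \<bar>b\<bar> * tensor_norm g i x (?T2 x)"
        by (rule tensor_norm_lincomb_le)
      finally have "tensor_norm g i x (?T x) ^ p \<le> (\<bar>a\<bar> * tensor_norm g i x (?T1 x) + \<bar>b\<bar> * tensor_norm g i x (?T2 x)) ^ p"
        by (intro power_mono tensor_norm_nonneg)
      also have "\<dots> \<le> 2 ^ p * ((\<bar>a\<bar> * tensor_norm g i x (?T1 x)) ^ p + (\<bar>b\<bar> * tensor_norm g i x (?T2 x)) ^ p)"
        by (intro add_power_le mult_nonneg_nonneg abs_ge_zero tensor_norm_nonneg)
      also have "\<dots> = ?B x" by (simp add: power_mult_distrib)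
      finally have "tensor_norm g i x (?T x) ^ p \<le> ?B x" .
      then show ?case using tensor_norm_nonneg[of g i x "?T x"] by (simp add: zero_le_power)
    qed
  qed
qed

definition nabla_inner :: "nat \<Rightarrow> real^3 \<Rightarrow> (real^3 \<Rightarrow> real^'m) \<Rightarrow> (real^3 \<Rightarrow> real^'m) \<Rightarrow> real" where
  "nabla_inner i x f h = tensor_inner g i x (nabla g f i x) (nabla g h i x)"

lemma nabla_inner_lincomb:
  fixes f f1 f2 s :: "real^3 \<Rightarrow> real^'m"
  assumes f: "f1 \<in> sobolev_fun g k p" "f2 \<in> sobolev_fun g k p" "f \<in> borel_measurable (vol g)"
    and eq: "AE x in vol g. f x = a *\<^sub>R f1 x + b *\<^sub>R f2 x" and s: "s \<in> sobolev_fun g k p" and i: "i \<le> k"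
  shows "AE x in vol g. nabla_inner i x f s = a * nabla_inner i x f1 s + b * nabla_inner i x f2 s"
proof -
  have f': "f \<in> sobolev_fun g k p" by (rule sobolev_fun_lincomb[OF f eq])
  note mt = sobolev_fun_measurable_tensor[OF f' i] sobolev_fun_measurable_tensor[OF f(1) i]
    sobolev_fun_measurable_tensor[OF f(2) i] sobolev_fun_measurable_tensor[OF s i]
  have "tensor_AE_eq i (nabla g s i) (nabla g s i)" by (simp add: tensor_AE_eq_def)
  from tensor_inner_AE_cong[OF g mt(1,4)[THEN measurable_tensor_field]
      measurable_tensor_lincomb[OF mt(2,3), THEN measurable_tensor_field] mt(4)[THEN measurable_tensor_field]
      sobolev_fun_nabla_lincomb[OF f eq i] this]
  show ?thesis unfolding nabla_inner_def tensor_inner_lincomb_left .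
qed

lemma sobolev_energy_nonneg: "sobolev_energy g k p f \<ge> 0"
  unfolding sobolev_energy_def by (intro sum_nonneg Bochner_Integration.integral_nonneg zero_le_power tensor_norm_nonneg)

lemma sobolev_energy_cong_AE:
  fixes f h :: "real^3 \<Rightarrow> real^'m"
  assumes f: "f \<in> sobolev_fun g k p" "h \<in> sobolev_fun g k p" "AE x in vol g. h x = f x"
  shows "sobolev_energy g k p h = sobolev_energy g k p f"
  unfolding sobolev_energy_def
proof (intro sum.cong refl integral_cong_AE)
  fix i assume "i \<in> {..k}"
  then have i: "i \<le> k" by simp
  note mt = sobolev_fun_measurable_tensor[OF f(1) i] sobolev_fun_measurable_tensor[OF f(2) i]
  show "(\<lambda>x. tensor_norm g i x (nabla g h i x) ^ p) \<in> borel_measurable (vol g)"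
    "(\<lambda>x. tensor_norm g i x (nabla g f i x) ^ p) \<in> borel_measurable (vol g)"
    using tensor_norm_measurable[OF mt(1)] tensor_norm_measurable[OF mt(2)] by simp_all
  have h: "h \<in> borel_measurable (vol g)" using f(2) by (simp add: sobolev_fun_def)
  \<comment> \<open>Almost everywhere equality is treated as a linear combination with coefficients
    1 and 0.\<close>
  have "AE x in vol g. h x = 1 *\<^sub>R f x + 0 *\<^sub>R f x" using f(3) by simp
  from sobolev_fun_nabla_lincomb[OF f(1) f(1) h this i]
  have eq: "tensor_AE_eq i (nabla g h i) (nabla g f i)" by simp
  show "AE x in vol g. tensor_norm g i x (nabla g h i x) ^ p = tensor_norm g i x (nabla g f i x) ^ p"
    using tensor_inner_AE_cong[OF g mt(2,2,1,1)[THEN measurable_tensor_field] eq eq]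
    by eventually_elim (simp add: tensor_norm_eq_sqrt)
qed

lemma rep_sobolev_class:
  fixes f :: "real^3 \<Rightarrow> real^'m"
  assumes "f \<in> sobolev_fun g k p"
  shows "rep (sobolev_class g k p f) \<in> sobolev_fun g k p"
    "AE x in vol g. rep (sobolev_class g k p f) x = f x"
proof -
  have "f \<in> sobolev_class g k p f" using assms by (simp add: sobolev_class_def)
  then have "rep (sobolev_class g k p f) \<in> sobolev_class g k p f" unfolding rep_def
    by (rule someI[where P = "\<lambda>h. h \<in> sobolev_class g k p f"])
  then show "rep (sobolev_class g k p f) \<in> sobolev_fun g k p"
    "AE x in vol g. rep (sobolev_class g k p f) x = f x" by (auto simp: sobolev_class_def)
qed

lemma rep_in_sobolev_fun:
  "F \<in> sobolev_space g k p \<Longrightarrow> rep (F :: (real^3 \<Rightarrow> real^'m) set) \<in> sobolev_fun g k p"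
  using rep_sobolev_class(1) unfolding sobolev_space_def by blast

lemma sobolev_add_scale_in_fun:
  fixes F H :: "(real^3 \<Rightarrow> real^'m) set"
  assumes "F \<in> sobolev_space g k p" "H \<in> sobolev_space g k p"
  shows "(\<lambda>x. rep F x + rep H x) \<in> sobolev_fun g k p" "(\<lambda>x. c *\<^sub>R rep F x) \<in> sobolev_fun g k p"
proof -
  note r = assms[THEN rep_in_sobolev_fun]
  have [measurable]: "rep F \<in> borel_measurable (vol g)" "rep H \<in> borel_measurable (vol g)"
    using r by (auto simp: sobolev_fun_def)
  show "(\<lambda>x. rep F x + rep H x) \<in> sobolev_fun g k p"
    by (rule sobolev_fun_lincomb[OF r, where a = 1 and b = 1]) auto
  show "(\<lambda>x. c *\<^sub>R rep F x) \<in> sobolev_fun g k p"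
    by (rule sobolev_fun_lincomb[OF r, where a = c and b = 0]) auto
qed

section \<open>The bounded multilinear form on the Sobolev space\<close>

definition sobolev_form :: "(real^3 \<Rightarrow> real^'m) list \<Rightarrow> real" where
  "sobolev_form fs = (\<Sum>i\<le>k. LINT x|vol g. paired_product (nabla_inner i x) fs)"

context
  assumes p: "even p" "p > 0"
begin

lemma sobolev_norm_power: "sobolev_norm g k p F ^ p = sobolev_energy g k p (rep F)"
  unfolding sobolev_norm_def by (rule real_root_pow_pos2[OF p(2) sobolev_energy_nonneg])

lemma sobolev_norm_nonneg: "sobolev_norm g k p F \<ge> 0"
  unfolding sobolev_norm_def using sobolev_energy_nonneg by (rule real_root_ge_zero)

text \<open>The Hoelder-type bound is applied with the \<open>p\<close>-th root of the whole energy
  as constant for each factor: the integral of order \<open>i\<close> is one of the nonnegative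
  summands of the energy.\<close>

lemma
  fixes fs :: "(real^3 \<Rightarrow> real^'m) list"
  assumes fs: "length fs = p" "set fs \<subseteq> sobolev_fun g k p" and i: "i \<le> k"
  shows integrable_paired_product: "integrable (vol g) (\<lambda>x. paired_product (nabla_inner i x) fs)"
    and integral_paired_product_le: "\<bar>LINT x|vol g. paired_product (nabla_inner i x) fs\<bar>
      \<le> real p * prod_list (map (\<lambda>f. root p (sobolev_energy g k p f)) fs)"
proof -
  define n where "n f x = tensor_norm g i x (nabla g f i x)" for f :: "real^3 \<Rightarrow> real^'m" and x
  have m: "(\<lambda>x. paired_product (nabla_inner i x) fs) \<in> borel_measurable (vol g)"
    unfolding nabla_inner_def using fs(2) i
    by (intro paired_product_measurable tensor_inner_measurable[OF g] sobolev_fun_measurable_tensor) auto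
  have b: "\<bar>paired_product (nabla_inner i x) fs\<bar> \<le> prod_list (map (\<lambda>f. n f x) fs)" for x
    unfolding nabla_inner_def n_def using fs p
    by (intro paired_product_le tensor_inner_le_norm tensor_norm_nonneg) auto
  have int: "integrable (vol g) (\<lambda>x. n f x ^ p)" if "f \<in> set fs" for f
    using that fs(2) i by (auto simp: n_def sobolev_fun_iff)
  have nn: "0 \<le> n f x" for f x unfolding n_def by (rule tensor_norm_nonneg)
  have c: "(LINT x|vol g. n f x ^ p) \<le> root p (sobolev_energy g k p f) ^ p" if "f \<in> set fs" for f
  proof -
    have "(LINT x|vol g. n f x ^ p) \<le> sobolev_energy g k p f"
      unfolding sobolev_energy_def n_def using i
      by (intro member_le_sum[where f = "\<lambda>i. LINT x|vol g. tensor_norm g i x (nabla g f i x) ^ p"])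
         (auto intro!: Bochner_Integration.integral_nonneg zero_le_power tensor_norm_nonneg)
    then show ?thesis by (simp add: real_root_pow_pos2[OF p(2) sobolev_energy_nonneg])
  qed
  have c0: "0 \<le> root p (sobolev_energy g k p f)" for f :: "real^3 \<Rightarrow> real^'m"
    using sobolev_energy_nonneg by (rule real_root_ge_zero)
  show "integrable (vol g) (\<lambda>x. paired_product (nabla_inner i x) fs)"
    "\<bar>LINT x|vol g. paired_product (nabla_inner i x) fs\<bar> \<le> real p * prod_list (map (\<lambda>f. root p (sobolev_energy g k p f)) fs)"
    using integral_prod_list_bound[OF fs(1) p(2) m b nn int c0 c] by blast+
qed

text \<open>The null set off which \<open>nabla_inner\<close> is linear depends on the partner, but
  only the finitely many entries of \<open>xs\<close> and \<open>ys\<close> can be partners.\<close>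

lemma sobolev_form_lincomb:
  fixes f f1 f2 :: "real^3 \<Rightarrow> real^'m"
  assumes f: "f1 \<in> sobolev_fun g k p" "f2 \<in> sobolev_fun g k p" "f \<in> sobolev_fun g k p"
    and eq: "AE x in vol g. f x = a *\<^sub>R f1 x + b *\<^sub>R f2 x"
    and l: "length xs + 1 + length ys = p" "set xs \<subseteq> sobolev_fun g k p" "set ys \<subseteq> sobolev_fun g k p"
  shows "sobolev_form (xs @ f # ys) = a * sobolev_form (xs @ f1 # ys) + b * sobolev_form (xs @ f2 # ys)"
proof -
  have fm: "f \<in> borel_measurable (vol g)" using f(3) by (simp add: sobolev_fun_def)
  have "(LINT x|vol g. paired_product (nabla_inner i x) (xs @ f # ys)) =
      a * (LINT x|vol g. paired_product (nabla_inner i x) (xs @ f1 # ys))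
      + b * (LINT x|vol g. paired_product (nabla_inner i x) (xs @ f2 # ys))" if i: "i \<le> k" for i
  proof -
    have int: "integrable (vol g) (\<lambda>x. paired_product (nabla_inner i x) (xs @ h # ys))"
      if "h \<in> sobolev_fun g k p" for h
      using that l by (intro integrable_paired_product i) auto
    have "AE x in vol g. \<forall>s\<in>set (xs @ ys). nabla_inner i x f s = a * nabla_inner i x f1 s + b * nabla_inner i x f2 s"
      unfolding AE_finite_all[OF finite_set] using l
      by (intro ballI nabla_inner_lincomb[OF f(1,2) fm eq _ i]) auto
    then have "AE x in vol g. paired_product (nabla_inner i x) (xs @ f # ys) =
       a * paired_product (nabla_inner i x) (xs @ f1 # ys) + b * paired_product (nabla_inner i x) (xs @ f2 # ys)"
    proof eventually_elim
      case (elim x)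
      have comm: "nabla_inner i x h h' = nabla_inner i x h' h" for h h' :: "real^3 \<Rightarrow> real^'m"
        unfolding nabla_inner_def by (rule tensor_inner_commute)
      show ?case
        using elim comm l(1) p by (intro paired_product_lincomb) auto
    qed
    then have "(LINT x|vol g. paired_product (nabla_inner i x) (xs @ f # ys)) =
       (LINT x|vol g. a * paired_product (nabla_inner i x) (xs @ f1 # ys) + b * paired_product (nabla_inner i x) (xs @ f2 # ys))"
      using int[OF f(1)] int[OF f(2)] int[OF f(3)] by (intro integral_cong_AE) auto
    also have "\<dots> = a * (LINT x|vol g. paired_product (nabla_inner i x) (xs @ f1 # ys))
      + b * (LINT x|vol g. paired_product (nabla_inner i x) (xs @ f2 # ys))"
      using int[OF f(1)] int[OF f(2)] by simp
    finally show ?thesis .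
  qed
  then show ?thesis
    unfolding sobolev_form_def by (simp add: sum.distrib sum_distrib_left)
qed

text \<open>With \<open>p = 2 * m\<close> the product on the diagonal is \<open><T, T> ^ m\<close>,
  which is the \<open>p\<close>-th power of the norm; for odd \<open>p\<close> a square root would
  remain.\<close>

lemma sobolev_form_replicate: "sobolev_form (replicate p f) = sobolev_energy g k p f"
proof -
  obtain m where m: "p = 2 * m" using p(1) by blast
  have "paired_product (nabla_inner i x) (replicate p f) = tensor_norm g i x (nabla g f i x) ^ p" for i x
    unfolding m paired_product_replicate
    by (simp add: nabla_inner_def tensor_norm_eq_sqrt power_mult tensor_inner_nonneg)
  then show ?thesis by (simp add: sobolev_form_def sobolev_energy_def)
qed

lemma frechet_smooth_sobolev_norm_power:
  "frechet_smooth (sobolev_space g k p :: (real^3 \<Rightarrow> real^'m) set set)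
     (sobolev_add g k p) (sobolev_scale g k p) (sobolev_norm g k p) (\<lambda>F. sobolev_norm g k p F ^ p)"
proof (rule frechet_smooth_diagonal)
  let ?V = "sobolev_space g k p :: (real^3 \<Rightarrow> real^'m) set set"
  let ?B = "\<lambda>Fs :: (real^3 \<Rightarrow> real^'m) set list. sobolev_form (map rep Fs)"
  show "sobolev_add g k p F H \<in> ?V" if "F \<in> ?V" "H \<in> ?V" for F H
    using sobolev_add_scale_in_fun(1)[OF that] by (simp add: sobolev_add_def sobolev_space_def)
  show "0 \<le> sobolev_norm g k p F" for F :: "(real^3 \<Rightarrow> real^'m) set" by (rule sobolev_norm_nonneg)
  show "sobolev_norm g k p F ^ p = ?B (replicate p F)" for F :: "(real^3 \<Rightarrow> real^'m) set"
    by (simp add: sobolev_norm_power sobolev_form_replicate)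
  \<comment> \<open>There are \<open>Suc k\<close> orders of differentiation, each contributing the
    factor \<open>p\<close> of the integral bound.\<close>
  show "bounded_form (sobolev_norm g k p) ?V p (real (Suc k) * real p) ?B"
    unfolding bounded_form_def
  proof (intro allI impI)
    fix Fs assume Fs: "length Fs = p" "set Fs \<subseteq> ?V"
    have "\<bar>?B Fs\<bar> \<le> (\<Sum>i\<le>k. \<bar>LINT x|vol g. paired_product (nabla_inner i x) (map rep Fs)\<bar>)"
      unfolding sobolev_form_def by (rule sum_abs)
    also have "\<dots> \<le> (\<Sum>i\<le>k. real p * prod_list (map (\<lambda>f. root p (sobolev_energy g k p f)) (map rep Fs)))"
      using Fs rep_in_sobolev_fun by (intro sum_mono integral_paired_product_le) auto
    also have "\<dots> = real (Suc k) * real p * prod_list (map (sobolev_norm g k p) Fs)"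
      by (simp add: sobolev_norm_def[abs_def] comp_def)
    finally show "\<bar>?B Fs\<bar> \<le> real (Suc k) * real p * prod_list (map (sobolev_norm g k p) Fs)" .
  qed
  show "multilinear_on (sobolev_add g k p) (sobolev_scale g k p) ?V p ?B"
    unfolding multilinear_on_def
  proof (intro allI impI conjI ballI)
    fix Xs Ys F assume l: "length Xs + 1 + length Ys = p" "set Xs \<subseteq> ?V" "set Ys \<subseteq> ?V" and F: "F \<in> ?V"
    have l': "length (map rep Xs) + 1 + length (map rep Ys) = p"
      "set (map rep Xs) \<subseteq> sobolev_fun g k p" "set (map rep Ys) \<subseteq> sobolev_fun g k p"
      using l rep_in_sobolev_fun by auto
    note rF = rep_in_sobolev_fun[OF F]
    show "?B (Xs @ sobolev_add g k p F H # Ys) = ?B (Xs @ F # Ys) + ?B (Xs @ H # Ys)" if H: "H \<in> ?V" for H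
    proof -
      note r = rep_sobolev_class[OF sobolev_add_scale_in_fun(1)[OF F H], folded sobolev_add_def]
      \<comment> \<open>The representative of a sum is a fresh choice, equal to the sum of the
        representatives only almost everywhere; this is why \<open>sobolev_form_lincomb\<close>
        takes an arbitrary such \<open>f\<close>.\<close>
      have "AE x in vol g. rep (sobolev_add g k p F H) x = 1 *\<^sub>R rep F x + 1 *\<^sub>R rep H x"
        using r(2) by simp
      from sobolev_form_lincomb[OF rF rep_in_sobolev_fun[OF H] r(1) this l'] show ?thesis by simp
    qed
    show "?B (Xs @ sobolev_scale g k p c F # Ys) = c *\<^sub>R ?B (Xs @ F # Ys)" for c
    proof -
      note r = rep_sobolev_class[OF sobolev_add_scale_in_fun(2)[OF F F], of c, folded sobolev_scale_def]
      have "AE x in vol g. rep (sobolev_scale g k p c F) x = c *\<^sub>R rep F x + 0 *\<^sub>R rep F x"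
        using r(2) by simp
      from sobolev_form_lincomb[OF rF rF r(1) this l'] show ?thesis by simp
    qed
  qed
qed

end

end

text \<open>\<open>sobolev_norm\<close> is evaluated on a chosen representative. The first conjunct
  ties it to the integrals of every representative, so that the second one is about the intended
  function.\<close>

theorem theorem5p1:
  fixes g :: metric and k p :: nat
  assumes "riemannian_metric g" and "even p" and "p > 0"
  shows "(\<forall>f \<in> (sobolev_fun g k p :: (real^3 \<Rightarrow> real^'m) set).
            sobolev_norm g k p (sobolev_class g k p f) ^ p =
              (\<Sum>i\<le>k. LINT x|vol g. tensor_norm g i x (nabla g f i x) ^ p)) \<and>
         frechet_smooth (sobolev_space g k p :: (real^3 \<Rightarrow> real^'m) set set)
           (sobolev_add g k p) (sobolev_scale g k p) (sobolev_norm g k p)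
           (\<lambda>F. sobolev_norm g k p F ^ p)"
proof (intro conjI ballI)
  fix f :: "real^3 \<Rightarrow> real^'m" assume f: "f \<in> sobolev_fun g k p"
  have "sobolev_norm g k p (sobolev_class g k p f) ^ p = sobolev_energy g k p f"
    unfolding sobolev_norm_power[OF assms]
    by (rule sobolev_energy_cong_AE[OF assms(1) f rep_sobolev_class[OF assms(1) f]])
  then show "sobolev_norm g k p (sobolev_class g k p f) ^ p =
      (\<Sum>i\<le>k. LINT x|vol g. tensor_norm g i x (nabla g f i x) ^ p)"
    by (simp add: sobolev_energy_def)
qed (rule frechet_smooth_sobolev_norm_power[OF assms])

end
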